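(* Let $c \in \mathbb{R}$ be fixed. For any choice of rational numbers $a>1$ and $b>0$, there exist a function $\psi \in L^2(\mathbb{R}^2)$ and a set $\Lambda \subset \mathbb{R}^2$ such that $\left( D_{A_{a^k}} D_{S_{mb}} T_\lambda \psi \right)_{k,m\in\mathbb{Z},\ \lambda\in\Lambda}$ is a Riesz basis of $L^2(\mathbb{R}^2)$.
   Context: For $t\in\mathbb{R}^+$ and $m\in\mathbb{R}$ define $A_t = \begin{pmatrix} t & 0 \\ 0 & t^{c}\end{pmatrix}$ and $S_m = \begin{pmatrix} 1 & m \\ 0 & 1\end{pmatrix}$, where $c\in\mathbb{R}$ is a fixed anisotropy parameter. On $L^2(\mathbb{R}^2)$ put $(T_\lambda f)(x) = f(x-\lambda)$ for $\lambda\in\mathbb{R}^2$ and $(D_A f)(x) = |\det A|^{-1/2} f(A^{-1}x)$ for $A\in Gl(2,\mathbb{R})$. A Riesz basis of a Hilbert space $\mathcal{H}$ is a family $(g_i)_{i\in I}$ spanning a dense subspace for which there are constants $0<C_1\le C_2$ with $C_1\sum_i |c_i|^2 \le \|\sum_i c_i g_i\|^2 \le C_2 \sum_i |c_i|^2$ for all finitely supported complex families $(c_i)_{i\in I}$. *)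

theory Defs
  imports "HOL-Analysis.Analysis"
begin

text \<open>
  Elements of \<open>L\<^sup>2(M)\<close> are represented by functions instead of classes modulo equality almost
  everywhere. All notions below depend on these functions only through measurability and through
  the seminorm \<open>L2_norm\<close>, so they do not depend on the choice of representatives
  (\<open>lebesgue\<close> is complete).
\<close>

definition L2 :: "'a measure \<Rightarrow> ('a \<Rightarrow> complex) set" where
  "L2 M = {f \<in> borel_measurable M. integrable M (\<lambda>x. (norm (f x))\<^sup>2)}"

definition L2_norm :: "'a measure \<Rightarrow> ('a \<Rightarrow> complex) \<Rightarrow> real" where
  "L2_norm M f = sqrt (\<integral>x. (norm (f x))\<^sup>2 \<partial>M)"

text \<open>
  A finitely supported family of coefficients is given by a finite set \<open>J \<subseteq> I\<close> containing the
  support and the values on \<open>J\<close>.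
\<close>

definition riesz_basis_L2 :: "'a measure \<Rightarrow> 'i set \<Rightarrow> ('i \<Rightarrow> 'a \<Rightarrow> complex) \<Rightarrow> bool" where
  "riesz_basis_L2 M I g \<longleftrightarrow>
     (\<forall>i\<in>I. g i \<in> L2 M) \<and>
     (\<forall>f\<in>L2 M. \<forall>\<epsilon>>0. \<exists>J u. finite J \<and> J \<subseteq> I \<and>
        L2_norm M (\<lambda>x. f x - (\<Sum>i\<in>J. u i * g i x)) < \<epsilon>) \<and>
     (\<exists>C1 C2. 0 < C1 \<and> C1 \<le> C2 \<and>
        (\<forall>J u. finite J \<and> J \<subseteq> I \<longrightarrow>
           C1 * (\<Sum>i\<in>J. (norm (u i))\<^sup>2) \<le> (L2_norm M (\<lambda>x. \<Sum>i\<in>J. u i * g i x))\<^sup>2 \<and>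
           (L2_norm M (\<lambda>x. \<Sum>i\<in>J. u i * g i x))\<^sup>2 \<le> C2 * (\<Sum>i\<in>J. (norm (u i))\<^sup>2)))"

text \<open>Only meant for \<open>t > 0\<close>, as \<open>powr\<close> is a genuine power only there.\<close>

definition dilation_matrix :: "real \<Rightarrow> real \<Rightarrow> real^2^2" where
  "dilation_matrix c t = vector [vector [t, 0], vector [0, t powr c]]"

definition shear_matrix :: "real \<Rightarrow> real^2^2" where
  "shear_matrix m = vector [vector [1, m], vector [0, 1]]"

definition translation_op :: "real^2 \<Rightarrow> (real^2 \<Rightarrow> complex) \<Rightarrow> real^2 \<Rightarrow> complex" where
  "translation_op l f = (\<lambda>x. f (x - l))"

text \<open>Only meant for invertible \<open>A\<close>.\<close>

definition dilation_op :: "real^2^2 \<Rightarrow> (real^2 \<Rightarrow> complex) \<Rightarrow> real^2 \<Rightarrow> complex" where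
  "dilation_op A f = (\<lambda>x. complex_of_real (\<bar>det A\<bar> powr (- 1 / 2)) * f (matrix_inv A *v x))"

end

theory Submission
  imports Defs
begin

text \<open>
  On the Fourier side the operators \<open>D\<^bsub>A\<^esub> D\<^bsub>S\<^esub>\<close> act by \<open>\<xi> \<mapsto> S\<^sup>T A\<^sup>T \<xi>\<close> and translations by multiplication
  with exponentials. If a bounded set \<open>\<Omega>\<close> tiles the plane (up to a null set) under these linear maps
  and also tiles it under translations by a lattice, then the exponentials of the dual lattice \<open>\<Lambda>\<close>
  form an orthogonal basis of \<open>L\<^sup>2(\<Omega>)\<close>, and taking for \<open>\<psi>\<close> the normalised inverse Fourier transform of
  the indicator of \<open>\<Omega>\<close> even gives an orthonormal basis.

  The linear maps only require that the fibre of \<open>\<Omega>\<close> over \<open>x\<close> is an interval of length \<open>b \<bar>x\<bar>\<close> for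
  \<open>1 \<le> x < a\<close> and \<open>- a \<le> x < - 1\<close>; its position is free. The lengths over \<open>x\<close> and \<open>x - (a + 1)\<close> add up to
  the constant \<open>b (a + 1)\<close>, so modulo \<open>a + 1\<close> the two halves can be put together to a rectangle of
  width \<open>a - 1\<close>. If \<open>a\<close> is rational, \<open>a - 1 = N p\<close> and \<open>a + 1 = M p\<close> for integers \<open>N\<close>, \<open>M\<close>, and stacking the
  \<open>N\<close> strips of width \<open>p\<close> of this rectangle yields a tile for the lattice with periods \<open>p\<close> and
  \<open>N b (a + 1)\<close>.

  Plancherel's theorem is obtained from Parseval's identity on a large cube, applied to a function
  times an exponential and integrated over the frequency of the latter.
\<close>

subsection \<open>Square-integrable functions\<close>

text \<open>The transpose of the dilation by \<open>t\<close> times the shear by \<open>m b\<close>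
  sends \<open>(x, y)\<close> to \<open>(t x, t powr c * y + m b t x)\<close>. The first coordinate
  alone fixes the scale; at that scale the power of \<open>t\<close> only relocates the point in its
  fibre, and the shears move it in steps of \<open>b\<close> times the scaled first coordinate.
  Hence only the lengths of fibres matter, and one set serves for every \<open>c\<close>. The
  obstacle is that fibres of length proportional to \<open>|x|\<close> force slanted boundaries,
  whereas orthogonal exponentials call for a lattice. The period \<open>p\<close> must divide
  \<open>a + 1\<close>, so that the halves interlock, and \<open>a - 1\<close>, so that whole strips
  fill the range of \<open>x\<close>; such a \<open>p\<close> exists exactly when
  \<open>(a + 1) / (a - 1)\<close> is rational. The ranges \<open>[1, a)\<close> and
  \<open>[- a, - 1)\<close> are half-open on the same side because translation by
  \<open>a + 1\<close> has to carry the second onto the first. The transform is used as an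
  absolutely convergent integral, on square-integrable functions of bounded support; all atoms are
  of this kind, and density arguments supply the rest.\<close>

definition L2_sqnorm :: "'a measure \<Rightarrow> ('a \<Rightarrow> complex) \<Rightarrow> real" where
  "L2_sqnorm M f = (\<integral>x. (norm (f x))\<^sup>2 \<partial>M)"

lemma L2_sqnorm_nonneg [simp]: "L2_sqnorm M f \<ge> 0"
  by (simp add: L2_sqnorm_def)

lemma L2_norm_eq: "L2_norm M f = sqrt (L2_sqnorm M f)"
  by (simp add: L2_sqnorm_def L2_norm_def)

lemma L2_norm_power2: "(L2_norm M f)\<^sup>2 = L2_sqnorm M f"
  by (simp add: L2_norm_eq)

lemma L2I: "f \<in> borel_measurable M \<Longrightarrow> integrable M (\<lambda>x. (norm (f x))\<^sup>2) \<Longrightarrow> f \<in> L2 M"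
  by (simp add: L2_def)

lemma L2D:
  assumes "f \<in> L2 M"
  shows L2_measurable: "f \<in> borel_measurable M"
    and L2_integrable: "integrable M (\<lambda>x. (norm (f x))\<^sup>2)"
  using assms by (simp_all add: L2_def)

lemma L2_bound:
  assumes "f \<in> borel_measurable M" "g \<in> L2 M" "\<And>x. norm (f x) \<le> C * norm (g x)"
  shows "f \<in> L2 M"
proof (rule L2I[OF assms(1)], rule Bochner_Integration.integrable_bound)
  show "integrable M (\<lambda>x. C\<^sup>2 * (norm (g x))\<^sup>2)"
    using L2_integrable[OF assms(2)] by simp
  show "(\<lambda>x. (norm (f x))\<^sup>2) \<in> borel_measurable M"
    using assms(1) by measurable
  show "AE x in M. norm ((norm (f x))\<^sup>2) \<le> norm (C\<^sup>2 * (norm (g x))\<^sup>2)"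
    by (auto simp: power_mult_distrib[symmetric] intro!: power_mono assms(3))
qed

lemma L2_zero [simp]: "(\<lambda>x. 0) \<in> L2 M"
  by (simp add: L2_def)

lemma L2_cmult: "f \<in> L2 M \<Longrightarrow> (\<lambda>x. c * f x) \<in> L2 M"
  by (rule L2_bound[where C = "norm c"]) (auto dest: L2_measurable simp: norm_mult)

lemma norm_add_power2: "(norm (a + b))\<^sup>2 \<le> 2 * (norm a)\<^sup>2 + 2 * (norm (b :: complex))\<^sup>2"
proof -
  have "(norm (a + b))\<^sup>2 \<le> (norm a + norm b)\<^sup>2"
    by (intro power_mono norm_triangle_ineq) auto
  also have "\<dots> \<le> 2 * (norm a)\<^sup>2 + 2 * (norm b)\<^sup>2"
    using zero_le_power2[of "norm a - norm b"] by (simp add: power2_sum power2_diff)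
  finally show ?thesis .
qed

lemma L2_add:
  assumes "f \<in> L2 M" "g \<in> L2 M"
  shows "(\<lambda>x. f x + g x) \<in> L2 M"
proof (rule L2I, goal_cases)
  case 1
  show ?case using assms[THEN L2_measurable] by measurable
next
  case 2
  show ?case
  proof (rule Bochner_Integration.integrable_bound)
    show "integrable M (\<lambda>x. 2 * (norm (f x))\<^sup>2 + 2 * (norm (g x))\<^sup>2)"
      using assms[THEN L2_integrable] by simp
    show "(\<lambda>x. (norm (f x + g x))\<^sup>2) \<in> borel_measurable M"
      using assms[THEN L2_measurable] by measurable
    show "AE x in M. norm ((norm (f x + g x))\<^sup>2) \<le> norm (2 * (norm (f x))\<^sup>2 + 2 * (norm (g x))\<^sup>2)"
      by (simp add: norm_add_power2)
  qed
qed

lemma L2_diff: "f \<in> L2 M \<Longrightarrow> g \<in> L2 M \<Longrightarrow> (\<lambda>x. f x - g x) \<in> L2 M"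
  using L2_add[of f M "\<lambda>x. (-1) * g x"] L2_cmult[of g M "-1"] by simp

lemma L2_sum: "(\<And>i. i \<in> J \<Longrightarrow> g i \<in> L2 M) \<Longrightarrow> (\<lambda>x. \<Sum>i\<in>J. g i x) \<in> L2 M"
  by (induction J rule: infinite_finite_induct) (auto intro: L2_add)

lemma borel_measurable_cnj [measurable]: "cnj \<in> borel_measurable borel"
  by (intro borel_measurable_continuous_onI continuous_intros)

lemma L2_cnj: "f \<in> L2 M \<Longrightarrow> (\<lambda>x. cnj (f x)) \<in> L2 M"
  by (rule L2_bound[where C = 1 and g = f]) (auto dest: L2_measurable)

lemma L2_integrable_mult:
  assumes "f \<in> L2 M" "g \<in> L2 M"
  shows "integrable M (\<lambda>x. f x * g x)"
proof (rule Bochner_Integration.integrable_bound)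
  show "integrable M (\<lambda>x. (norm (f x))\<^sup>2 + (norm (g x))\<^sup>2)"
    using assms[THEN L2_integrable] by simp
  show "(\<lambda>x. f x * g x) \<in> borel_measurable M"
    using assms[THEN L2_measurable] by measurable
  have "norm (f x) * norm (g x) \<le> (norm (f x))\<^sup>2 + (norm (g x))\<^sup>2" for x
    using sum_squares_bound[of "norm (f x)" "norm (g x)"]
      mult_nonneg_nonneg[OF norm_ge_zero[of "f x"] norm_ge_zero[of "g x"]] by linarith
  then show "AE x in M. norm (f x * g x) \<le> norm ((norm (f x))\<^sup>2 + (norm (g x))\<^sup>2)"
    by (auto simp: norm_mult)
qed

lemma L2_sqnorm_add_le:
  assumes "f \<in> L2 M" "g \<in> L2 M"
  shows "L2_sqnorm M (\<lambda>x. f x + g x) \<le> 2 * L2_sqnorm M f + 2 * L2_sqnorm M g"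
proof -
  have "L2_sqnorm M (\<lambda>x. f x + g x) \<le> (\<integral>x. 2 * (norm (f x))\<^sup>2 + 2 * (norm (g x))\<^sup>2 \<partial>M)"
    unfolding L2_sqnorm_def
    using assms[THEN L2_integrable] L2_integrable[OF L2_add[OF assms]]
    by (intro integral_mono) (auto simp: norm_add_power2)
  also have "\<dots> = 2 * L2_sqnorm M f + 2 * L2_sqnorm M g"
    using assms[THEN L2_integrable] by (simp add: L2_sqnorm_def)
  finally show ?thesis .
qed

lemma L2_sqnorm_cmult: "L2_sqnorm M (\<lambda>x. c * f x) = (norm c)\<^sup>2 * L2_sqnorm M f"
  by (simp add: L2_sqnorm_def norm_mult power_mult_distrib)

lemma L2_sqnorm_triangle:
  assumes "f \<in> L2 M" "g \<in> L2 M" "h \<in> L2 M"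
  shows "L2_sqnorm M (\<lambda>x. f x - h x)
           \<le> 2 * L2_sqnorm M (\<lambda>x. f x - g x) + 2 * L2_sqnorm M (\<lambda>x. g x - h x)"
  using L2_sqnorm_add_le[of "\<lambda>x. f x - g x" M "\<lambda>x. g x - h x"] assms by (simp add: L2_diff)

lemma L2_sqnorm_diff:
  assumes "f \<in> L2 M" "g \<in> L2 M"
  shows "L2_sqnorm M (\<lambda>x. f x - g x)
           = L2_sqnorm M f - 2 * Re (\<integral>x. f x * cnj (g x) \<partial>M) + L2_sqnorm M g"
proof -
  have i: "integrable M (\<lambda>x. f x * cnj (g x))"
    using assms by (intro L2_integrable_mult L2_cnj)
  have "(norm (f x - g x))\<^sup>2 = (norm (f x))\<^sup>2 - 2 * Re (f x * cnj (g x)) + (norm (g x))\<^sup>2" for x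
    by (simp add: cmod_power2 power2_diff algebra_simps)
  then have "L2_sqnorm M (\<lambda>x. f x - g x)
      = (\<integral>x. (norm (f x))\<^sup>2 - 2 * Re (f x * cnj (g x)) + (norm (g x))\<^sup>2 \<partial>M)"
    by (simp only: L2_sqnorm_def)
  also have "\<dots> = L2_sqnorm M f - 2 * (\<integral>x. Re (f x * cnj (g x)) \<partial>M) + L2_sqnorm M g"
    unfolding L2_sqnorm_def
    using assms[THEN L2_integrable] integrable_Re[OF i]
    by (simp del: times_complex.sel)
  also have "(\<integral>x. Re (f x * cnj (g x)) \<partial>M) = Re (\<integral>x. f x * cnj (g x) \<partial>M)"
    using i by (rule integral_Re)
  finally show ?thesis .
qed

text \<open>Parseval, Bessel's inequality and the best approximation property are all special cases.\<close>

lemma L2_sqnorm_orthonormal: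
  assumes "finite J" "f \<in> L2 M" "\<And>i. i \<in> J \<Longrightarrow> e i \<in> L2 M"
    and "\<And>i j. i \<in> J \<Longrightarrow> j \<in> J \<Longrightarrow> (\<integral>x. e i x * cnj (e j x) \<partial>M) = (if i = j then 1 else 0)"
  shows "L2_sqnorm M (\<lambda>x. f x - (\<Sum>i\<in>J. u i * e i x))
     = L2_sqnorm M f - (\<Sum>i\<in>J. (norm (\<integral>x. f x * cnj (e i x) \<partial>M))\<^sup>2)
         + (\<Sum>i\<in>J. (norm (u i - (\<integral>x. f x * cnj (e i x) \<partial>M)))\<^sup>2)"
  using assms
proof (induction J)
  case (insert i J)
  let ?S = "\<lambda>x. \<Sum>j\<in>J. u j * e j x"
  let ?c = "\<integral>x. f x * cnj (e i x) \<partial>M"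
  have e: "j \<in> J \<Longrightarrow> e j \<in> L2 M" "e i \<in> L2 M" for j
    using insert.prems by auto
  have S: "?S \<in> L2 M"
    by (intro L2_sum L2_cmult e)
  \<comment> \<open>By orthogonality, subtracting the earlier terms leaves the coefficient at
    \<open>e i\<close> unchanged.\<close>
  have "(\<integral>x. ?S x * cnj (e i x) \<partial>M) = (\<Sum>j\<in>J. u j * (\<integral>x. e j x * cnj (e i x) \<partial>M))"
    using e by (simp add: sum_distrib_right mult.assoc integrable_sum L2_integrable_mult L2_cnj)
  also have "\<dots> = 0"
    using insert.hyps insert.prems by (intro sum.neutral) auto
  finally have c: "(\<integral>x. (f x - ?S x) * cnj (e i x) \<partial>M) = ?c"
    using S e insert.prems(1) by (simp add: left_diff_distrib L2_integrable_mult L2_cnj)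
  have "L2_sqnorm M (e i) = 1"
  proof -
    have "complex_of_real (L2_sqnorm M (e i)) = (\<integral>x. e i x * cnj (e i x) \<partial>M)"
      unfolding L2_sqnorm_def by (subst integral_complex_of_real[symmetric])
        (simp only: complex_norm_square)
    also have "\<dots> = 1"
      using insert.prems by simp
    finally show ?thesis
      by simp
  qed
  then have "L2_sqnorm M (\<lambda>x. (f x - ?S x) - u i * e i x)
      = L2_sqnorm M (\<lambda>x. f x - ?S x) - 2 * Re (cnj (u i) * ?c) + (norm (u i))\<^sup>2"
  proof -
    have "(\<integral>x. (f x - ?S x) * cnj (u i * e i x) \<partial>M) = (\<integral>x. cnj (u i) * ((f x - ?S x) * cnj (e i x)) \<partial>M)"
      by (simp add: mult.left_commute)
    also have "\<dots> = cnj (u i) * ?c"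
      unfolding c[symmetric] by (rule integral_mult_right_zero)
    finally have "(\<integral>x. (f x - ?S x) * cnj (u i * e i x) \<partial>M) = cnj (u i) * ?c" .
    with \<open>L2_sqnorm M (e i) = 1\<close> show ?thesis
      using L2_sqnorm_diff[OF L2_diff[OF insert.prems(1) S] L2_cmult[OF e(2)], of "u i"]
      by (simp only: L2_sqnorm_cmult mult_1_right)
  qed
  \<comment> \<open>Completing the square in \<open>u i\<close>.\<close>
  also have "\<dots> = L2_sqnorm M (\<lambda>x. f x - ?S x) - (norm ?c)\<^sup>2 + (norm (u i - ?c))\<^sup>2"
    by (simp add: cmod_power2 power2_diff algebra_simps)
  finally show ?case
    using insert by (simp add: algebra_simps)
qed simp

section \<open>Linear spans and closures in the L2 seminorm\<close>

definition csubspace :: "('a \<Rightarrow> complex) set \<Rightarrow> bool" where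
  "csubspace V \<longleftrightarrow> (\<lambda>x. 0) \<in> V \<and> (\<forall>f\<in>V. \<forall>g\<in>V. (\<lambda>x. f x + g x) \<in> V) \<and>
     (\<forall>c. \<forall>f\<in>V. (\<lambda>x. c * f x) \<in> V)"

lemma csubspace_zero: "csubspace V \<Longrightarrow> (\<lambda>x. 0) \<in> V"
  and csubspace_add: "csubspace V \<Longrightarrow> f \<in> V \<Longrightarrow> g \<in> V \<Longrightarrow> (\<lambda>x. f x + g x) \<in> V"
  and csubspace_cmult: "csubspace V \<Longrightarrow> f \<in> V \<Longrightarrow> (\<lambda>x. c * f x) \<in> V"
  by (auto simp: csubspace_def)

lemma csubspace_diff: "csubspace V \<Longrightarrow> f \<in> V \<Longrightarrow> g \<in> V \<Longrightarrow> (\<lambda>x. f x - g x) \<in> V"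
  using csubspace_add[of V f "\<lambda>x. (-1) * g x"] csubspace_cmult[of V g "-1"] by simp

lemma csubspace_sum:
  "csubspace V \<Longrightarrow> (\<And>i. i \<in> J \<Longrightarrow> f i \<in> V) \<Longrightarrow> (\<lambda>x. \<Sum>i\<in>J. f i x) \<in> V"
  by (induction J rule: infinite_finite_induct) (auto intro: csubspace_zero csubspace_add)

definition lin_comb :: "'i set \<Rightarrow> ('i \<Rightarrow> 'a \<Rightarrow> complex) \<Rightarrow> ('a \<Rightarrow> complex) set" where
  "lin_comb I g = {\<lambda>x. \<Sum>i\<in>J. u i * g i x | J u. finite J \<and> J \<subseteq> I}"

lemma lin_combI: "finite J \<Longrightarrow> J \<subseteq> I \<Longrightarrow> (\<lambda>x. \<Sum>i\<in>J. u i * g i x) \<in> lin_comb I g"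
  by (auto simp: lin_comb_def)

lemma lin_combE:
  assumes "f \<in> lin_comb I g"
  obtains J u where "finite J" "J \<subseteq> I" "f = (\<lambda>x. \<Sum>i\<in>J. u i * g i x)"
  using assms by (auto simp: lin_comb_def)

lemma lin_comb_base: "i \<in> I \<Longrightarrow> g i \<in> lin_comb I g"
  using lin_combI[of "{i}" I "\<lambda>_. 1" g] by simp

lemma csubspace_lin_comb: "csubspace (lin_comb I g)"
  unfolding csubspace_def
proof (intro conjI ballI allI)
  show "(\<lambda>x. 0) \<in> lin_comb I g"
    using lin_combI[of "{}" I _ g] by simp
next
  fix f f' assume "f \<in> lin_comb I g" "f' \<in> lin_comb I g"
  then obtain J u J' u' where J: "finite J" "J \<subseteq> I" "f = (\<lambda>x. \<Sum>i\<in>J. u i * g i x)"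
    and J': "finite J'" "J' \<subseteq> I" "f' = (\<lambda>x. \<Sum>i\<in>J'. u' i * g i x)"
    by (elim lin_combE) blast
  define v where "v = (\<lambda>i. (if i \<in> J then u i else 0) + (if i \<in> J' then u' i else 0))"
  have "f x = (\<Sum>i\<in>J \<union> J'. (if i \<in> J then u i else 0) * g i x)" for x
    unfolding J by (intro sum.mono_neutral_cong_left) (use J J' in auto)
  moreover have "f' x = (\<Sum>i\<in>J \<union> J'. (if i \<in> J' then u' i else 0) * g i x)" for x
    unfolding J' by (intro sum.mono_neutral_cong_left) (use J J' in auto)
  ultimately have "(\<lambda>x. f x + f' x) = (\<lambda>x. \<Sum>i\<in>J \<union> J'. v i * g i x)"
    by (simp add: v_def distrib_right sum.distrib)
  then show "(\<lambda>x. f x + f' x) \<in> lin_comb I g"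
    using J J' by (auto intro!: lin_combI)
next
  fix c f assume "f \<in> lin_comb I g"
  then obtain J u where J: "finite J" "J \<subseteq> I" "f = (\<lambda>x. \<Sum>i\<in>J. u i * g i x)"
    by (elim lin_combE) blast
  then have "(\<lambda>x. c * f x) = (\<lambda>x. \<Sum>i\<in>J. (c * u i) * g i x)"
    by (simp add: sum_distrib_left mult.assoc)
  then show "(\<lambda>x. c * f x) \<in> lin_comb I g"
    using J lin_combI by metis
qed

lemma lin_comb_subset:
  assumes "csubspace V" "\<And>i. i \<in> I \<Longrightarrow> g i \<in> V"
  shows "lin_comb I g \<subseteq> V"
proof
  fix f assume "f \<in> lin_comb I g"
  then obtain J u where "finite J" "J \<subseteq> I" "f = (\<lambda>x. \<Sum>i\<in>J. u i * g i x)"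
    by (elim lin_combE) blast
  then show "f \<in> V"
    using assms by (auto intro!: csubspace_sum csubspace_cmult)
qed

lemma csubspace_L2: "csubspace (L2 M)"
  by (simp add: csubspace_def L2_add L2_cmult)

definition L2_closure :: "'a measure \<Rightarrow> ('a \<Rightarrow> complex) set \<Rightarrow> ('a \<Rightarrow> complex) set" where
  "L2_closure M V = {f \<in> L2 M. \<forall>e>0. \<exists>g\<in>V. L2_sqnorm M (\<lambda>x. f x - g x) < e}"

lemma L2_closureD: "f \<in> L2_closure M V \<Longrightarrow> f \<in> L2 M"
  by (simp add: L2_closure_def)

lemma L2_closureE:
  assumes "f \<in> L2_closure M V" "e > 0"
  obtains g where "g \<in> V" "L2_sqnorm M (\<lambda>x. f x - g x) < e"
  using assms by (auto simp: L2_closure_def)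

lemma L2_closureI:
  assumes "f \<in> L2 M" "\<And>e. e > 0 \<Longrightarrow> \<exists>g\<in>V. L2_sqnorm M (\<lambda>x. f x - g x) < e"
  shows "f \<in> L2_closure M V"
  using assms by (simp add: L2_closure_def)

lemma L2_closure_base: "f \<in> V \<Longrightarrow> f \<in> L2 M \<Longrightarrow> f \<in> L2_closure M V"
  by (rule L2_closureI) (auto simp: L2_sqnorm_def intro!: bexI[of _ f])

text \<open>Closures are idempotent. Passing through an intermediate function doubles squared norms,
  which is why two errors below \<open>e / 4\<close> are taken.\<close>

lemma L2_closure_limit:
  assumes "V \<subseteq> L2 M" "f \<in> L2 M"
    and "\<And>e. e > 0 \<Longrightarrow> \<exists>g\<in>L2_closure M V. L2_sqnorm M (\<lambda>x. f x - g x) < e"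
  shows "f \<in> L2_closure M V"
proof (rule L2_closureI[OF assms(2)])
  fix e :: real assume "e > 0"
  then obtain g where g: "g \<in> L2_closure M V" "L2_sqnorm M (\<lambda>x. f x - g x) < e / 4"
    using assms(3)[of "e / 4"] by auto
  then obtain h where h: "h \<in> V" "L2_sqnorm M (\<lambda>x. g x - h x) < e / 4"
    using L2_closureE[of g M V "e / 4"] \<open>e > 0\<close> by auto
  have "L2_sqnorm M (\<lambda>x. f x - h x) < e"
    using L2_sqnorm_triangle[OF assms(2) L2_closureD[OF g(1)] subsetD[OF assms(1) h(1)]] g h
    by linarith
  with h show "\<exists>h\<in>V. L2_sqnorm M (\<lambda>x. f x - h x) < e"
    by blast
qed

lemma csubspace_L2_closure:
  assumes "csubspace V" "V \<subseteq> L2 M"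
  shows "csubspace (L2_closure M V)"
  unfolding csubspace_def
proof (intro conjI ballI allI)
  show "(\<lambda>x. 0) \<in> L2_closure M V"
    by (intro L2_closure_base csubspace_zero[OF assms(1)] L2_zero)
next
  fix f g assume fg: "f \<in> L2_closure M V" "g \<in> L2_closure M V"
  show "(\<lambda>x. f x + g x) \<in> L2_closure M V"
  proof (rule L2_closureI)
    show "(\<lambda>x. f x + g x) \<in> L2 M"
      using fg by (auto intro: L2_add dest: L2_closureD)
    fix e :: real assume "e > 0"
    obtain f' where f': "f' \<in> V" "L2_sqnorm M (\<lambda>x. f x - f' x) < e / 4"
      using L2_closureE[OF fg(1), of "e / 4"] \<open>e > 0\<close> by auto
    obtain g' where g': "g' \<in> V" "L2_sqnorm M (\<lambda>x. g x - g' x) < e / 4"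
      using L2_closureE[OF fg(2), of "e / 4"] \<open>e > 0\<close> by auto
    have "L2_sqnorm M (\<lambda>x. (f x - f' x) + (g x - g' x))
        \<le> 2 * L2_sqnorm M (\<lambda>x. f x - f' x) + 2 * L2_sqnorm M (\<lambda>x. g x - g' x)"
      using fg f' g' assms by (intro L2_sqnorm_add_le L2_diff) (auto dest: L2_closureD)
    also have "\<dots> < e"
      using f' g' by simp
    finally have "L2_sqnorm M (\<lambda>x. (f x + g x) - (f' x + g' x)) < e"
      by (simp add: algebra_simps)
    moreover have "(\<lambda>x. f' x + g' x) \<in> V"
      using f' g' assms by (auto intro: csubspace_add)
    ultimately show "\<exists>h\<in>V. L2_sqnorm M (\<lambda>x. (f x + g x) - h x) < e"
      by (intro bexI[of _ "\<lambda>x. f' x + g' x"])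
  qed
next
  fix c f assume f: "f \<in> L2_closure M V"
  show "(\<lambda>x. c * f x) \<in> L2_closure M V"
  proof (rule L2_closureI)
    show "(\<lambda>x. c * f x) \<in> L2 M"
      using f by (auto intro: L2_cmult dest: L2_closureD)
    fix e :: real assume "e > 0"
    have pos: "(norm c)\<^sup>2 + 1 > 0"
      by (simp add: add_nonneg_pos)
    obtain g where g: "g \<in> V" "L2_sqnorm M (\<lambda>x. f x - g x) < e / ((norm c)\<^sup>2 + 1)"
      using L2_closureE[OF f, of "e / ((norm c)\<^sup>2 + 1)"] \<open>e > 0\<close> pos by auto
    have "L2_sqnorm M (\<lambda>x. c * f x - c * g x) = (norm c)\<^sup>2 * L2_sqnorm M (\<lambda>x. f x - g x)"
      by (simp add: L2_sqnorm_cmult[symmetric] algebra_simps)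
    also have "\<dots> \<le> ((norm c)\<^sup>2 + 1) * L2_sqnorm M (\<lambda>x. f x - g x)"
      by (intro mult_right_mono) auto
    also have "\<dots> < e"
      using g(2) pos by (simp add: field_simps)
    finally show "\<exists>h\<in>V. L2_sqnorm M (\<lambda>x. c * f x - h x) < e"
      using g(1) assms by (intro bexI[of _ "\<lambda>x. c * g x"]) (auto intro: csubspace_cmult)
  qed
qed

text \<open>Dominated convergence upgrades almost everywhere limits under a square-integrable bound
  \<open>w\<close> to limits in norm. Most density arguments below end this way: disjoint unions,
  simple functions, continuous approximation of open sets, truncations, and sums over dilated
  pieces.\<close>

lemma L2_closure_dominated:
  assumes V: "V \<subseteq> L2 M" and f: "f \<in> borel_measurable M"
    and g: "\<And>n. g n \<in> L2_closure M V"
    and w: "integrable M (\<lambda>x. (w x)\<^sup>2)" and le: "\<And>n x. norm (g n x) \<le> w x"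
    and lim: "AE x in M. (\<lambda>n. g n x) \<longlonglongrightarrow> f x"
  shows "f \<in> L2_closure M V"
proof -
  have g': "g n \<in> L2 M" for n
    using g by (rule L2_closureD)
  have fw: "AE x in M. norm (f x) \<le> w x"
    using lim
  proof eventually_elim
    case (elim x)
    show ?case
      by (rule LIMSEQ_le_const2[OF tendsto_norm[OF elim]]) (use le in auto)
  qed
  have int: "integrable M (\<lambda>x. (norm (f x))\<^sup>2)"
  proof (rule Bochner_Integration.integrable_bound[OF w])
    show "(\<lambda>x. (norm (f x))\<^sup>2) \<in> borel_measurable M"
      using f by measurable
    show "AE x in M. norm ((norm (f x))\<^sup>2) \<le> norm ((w x)\<^sup>2)"
      using fw by eventually_elim (auto intro!: power_mono)
  qed
  have fL2: "f \<in> L2 M"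
    using f int by (rule L2I)
  have "(\<lambda>n. \<integral>x. (norm (f x - g n x))\<^sup>2 \<partial>M) \<longlonglongrightarrow> (\<integral>x. 0 \<partial>M)"
  proof (rule integral_dominated_convergence)
    show "integrable M (\<lambda>x. 4 * (w x)\<^sup>2)"
      using w by simp
    show "(\<lambda>x. (norm (f x - g n x))\<^sup>2) \<in> borel_measurable M" for n
      using f L2_measurable[OF g'[of n]] by measurable
    show "AE x in M. (\<lambda>n. (norm (f x - g n x))\<^sup>2) \<longlonglongrightarrow> 0"
      using lim
    proof eventually_elim
      case (elim x)
      have "(\<lambda>n. (norm (f x - g n x))\<^sup>2) \<longlonglongrightarrow> (norm (f x - f x))\<^sup>2"
        by (intro tendsto_intros elim)
      then show ?case
        by simp
    qed
    fix n
    show "AE x in M. norm ((norm (f x - g n x))\<^sup>2) \<le> 4 * (w x)\<^sup>2"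
      using fw
    proof eventually_elim
      case (elim x)
      have "norm (f x - g n x) \<le> 2 * w x"
        using norm_triangle_ineq4[of "f x" "g n x"] le[of n x] elim by linarith
      then have "(norm (f x - g n x))\<^sup>2 \<le> (2 * w x)\<^sup>2"
        by (intro power_mono) auto
      then show ?case
        by (simp add: power_mult_distrib)
    qed
  qed simp
  then have lim0: "(\<lambda>n. L2_sqnorm M (\<lambda>x. f x - g n x)) \<longlonglongrightarrow> 0"
    by (simp add: L2_sqnorm_def)
  show ?thesis
  proof (rule L2_closure_limit[OF V fL2])
    fix e :: real assume "e > 0"
    then have "eventually (\<lambda>n. L2_sqnorm M (\<lambda>x. f x - g n x) < e) sequentially"
      using lim0 by (intro order_tendstoD) auto
    then show "\<exists>g\<in>L2_closure M V. L2_sqnorm M (\<lambda>x. f x - g x) < e"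
      using g by (auto simp: eventually_sequentially)
  qed
qed

lemma L2_sqnorm_cong_AE:
  assumes "AE x in M. norm (f x) = norm (g x)" "f \<in> borel_measurable M" "g \<in> borel_measurable M"
  shows "L2_sqnorm M f = L2_sqnorm M g"
  unfolding L2_sqnorm_def
  by (rule integral_cong_AE) (use assms in \<open>auto intro!: borel_measurable_power borel_measurable_norm\<close>)

lemma L2_indicator:
  assumes "A \<in> sets M" "emeasure M A < \<infinity>"
  shows "(indicator A :: 'a \<Rightarrow> complex) \<in> L2 M"
proof (rule L2I)
  have "(\<lambda>x. (norm (indicator A x :: complex))\<^sup>2) = indicat_real A"
    by (auto simp: indicator_def)
  then show "integrable M (\<lambda>x. (norm (indicator A x :: complex))\<^sup>2)"
    using assms by simp
qed (use assms in measurable)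

text \<open>The sets with approximable indicator form a Dynkin system containing the open sets.\<close>

lemma L2_closure_borel:
  assumes fin: "finite_measure M" and sets: "sets M = sets borel"
    and V: "V \<subseteq> L2 M" "csubspace V"
    and open_V: "\<And>U. open U \<Longrightarrow> (indicator U :: 'a :: topological_space \<Rightarrow> complex) \<in> L2_closure M V"
  shows "L2 M \<subseteq> L2_closure M V"
proof -
  interpret finite_measure M by fact
  have space: "space M = UNIV"
    using sets_eq_imp_space_eq[OF sets] by simp
  note C = csubspace_L2_closure[OF V(2,1)]
  have ind: "(indicator A :: 'a \<Rightarrow> complex) \<in> L2_closure M V" if "A \<in> sets M" for A
  proof -
    have "Int_stable {S :: 'a set. open S}" "{S :: 'a set. open S} \<subseteq> Pow UNIV"
      by (auto simp: Int_stable_def)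
    moreover have "A \<in> sigma_sets UNIV {S :: 'a set. open S}"
      using that sets by (simp add: borel_def)
    ultimately show ?thesis
    proof (induction rule: sigma_sets_induct_disjoint)
      case (basic A)
      then show ?case using open_V by simp
    next
      case empty
      then show ?case using csubspace_zero[OF C] by (simp add: indicator_def[abs_def])
    next
      case (compl A)
      have "(indicator (UNIV - A) :: 'a \<Rightarrow> complex) = (\<lambda>x. indicator UNIV x - indicator A x)"
        by (auto simp: fun_eq_iff indicator_def)
      then show ?case
        using csubspace_diff[OF C open_V[OF open_UNIV] compl(2)] by simp
    next
      case (union A)
      have A: "A i \<in> sets M" for i
        using union(2) sets by (auto simp: borel_def)
      show ?case
      proof (rule L2_closure_dominated[OF V(1), where w = "\<lambda>_. 1"])
        fix n
        show "(\<lambda>x. \<Sum>i<n. indicator (A i) x :: complex) \<in> L2_closure M V"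
          by (intro csubspace_sum[OF C] union)
        have s: "(\<Sum>i<n. indicator (A i) x :: 'b :: real_normed_field) = indicator (\<Union>i<n. A i) x" for x :: 'a
          using union(1) by (subst indicator_UN_disjoint) (auto simp: disjoint_family_on_def)
        show "norm (\<Sum>i<n. indicator (A i) x :: complex) \<le> 1" for x
          unfolding s by (simp add: indicator_def)
      next
        show "AE x in M. (\<lambda>n. \<Sum>i<n. indicator (A i) x :: complex) \<longlonglongrightarrow> indicator (\<Union>i. A i) x"
        proof (intro AE_I2)
          fix x
          have s: "(\<Sum>i<n. indicator (A i) x :: complex) = indicator (\<Union>i<n. A i) x" for n
            using union(1) by (subst indicator_UN_disjoint) (auto simp: disjoint_family_on_def)
          show "(\<lambda>n. \<Sum>i<n. indicator (A i) x :: complex) \<longlonglongrightarrow> indicator (\<Union>i. A i) x"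
            unfolding s by (rule LIMSEQ_indicator_UN)
        qed
      qed (use A in auto)
    qed
  qed
  show ?thesis
  proof
    fix f assume f: "f \<in> L2 M"
    from borel_measurable_implies_sequence_metric[OF L2_measurable[OF f], of 0]
    obtain s where s: "\<And>i. simple_function M (s i)" "\<And>x. (\<lambda>i. s i x) \<longlonglongrightarrow> f x"
      and le: "\<And>i x. norm (s i x) \<le> 2 * norm (f x)"
      by (auto simp: space)
    show "f \<in> L2_closure M V"
    proof (rule L2_closure_dominated[OF V(1) L2_measurable[OF f], where g = s])
      fix n
      have fn: "finite (range (s n))"
        using s(1)[of n] by (simp add: simple_function_def space)
      \<comment> \<open>A simple function is the finite sum of its values times the indicators of
        its level sets, so the case of indicators suffices.\<close>
      have "s n = (\<lambda>x. \<Sum>y\<in>range (s n). y * indicator (s n -` {y}) x)"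
      proof
        fix x
        have "(\<Sum>y\<in>range (s n). y * indicator (s n -` {y}) x) = (\<Sum>y\<in>{s n x}. y * indicator (s n -` {y}) x)"
          by (rule sum.mono_neutral_right) (use fn in \<open>auto simp: indicator_def\<close>)
        then show "s n x = (\<Sum>y\<in>range (s n). y * indicator (s n -` {y}) x)"
          by simp
      qed
      moreover have "(\<lambda>x. \<Sum>y\<in>range (s n). y * indicator (s n -` {y}) x) \<in> L2_closure M V"
        using simple_functionD(2)[OF s(1)[of n]]
        by (intro csubspace_sum[OF C] csubspace_cmult[OF C] ind) (auto simp: space)
      ultimately show "s n \<in> L2_closure M V"
        by simp
    next
      show "integrable M (\<lambda>x. (2 * norm (f x))\<^sup>2)"
        using L2_integrable[OF f] by (simp add: power_mult_distrib)
    qed (use s le in auto)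
  qed
qed

subsection \<open>Tiles of a rectangular lattice\<close>

definition lattice_vec :: "real^'n \<Rightarrow> int^'n \<Rightarrow> real^'n" where
  "lattice_vec p n = (\<chi> i. p $ i * of_int (n $ i))"

text \<open>The dual lattice: when no \<open>p $ i\<close> vanishes, its inner products with lattice
  vectors are integers, so its exponentials are periodic.\<close>

definition dual_vec :: "real^'n \<Rightarrow> int^'n \<Rightarrow> real^'n" where
  "dual_vec p n = (\<chi> i. of_int (n $ i) / p $ i)"

definition wave :: "real^'n \<Rightarrow> real^'n \<Rightarrow> complex" where
  "wave l x = cis (2 * pi * (l \<bullet> x))"

text \<open>A fundamental domain in the strict sense, without an exceptional null set; this makes
  the projection onto it a total function.\<close>

definition tile :: "real^'n \<Rightarrow> (real^'n) set \<Rightarrow> bool" where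
  "tile p A \<longleftrightarrow> A \<in> sets borel \<and> (\<forall>x. \<exists>!n. x + lattice_vec p n \<in> A)"

text \<open>A density rather than a restricted space keeps the sigma-algebra of the whole space, so
  Borel functions need no restriction.\<close>

abbreviation lborel_restr :: "(real^'n) set \<Rightarrow> (real^'n) measure" where
  "lborel_restr A \<equiv> density lborel (indicator A)"

lemma tile_sets [measurable_dest]: "tile p A \<Longrightarrow> A \<in> sets borel"
  by (simp add: tile_def)

lemma lattice_vec_minus: "lattice_vec p (- n) = - lattice_vec p n"
  by (simp add: lattice_vec_def vec_eq_iff)

lemma dual_vec_diff: "dual_vec p (m - n) = dual_vec p m - dual_vec p n"
  and dual_vec_minus: "dual_vec p (- n) = - dual_vec p n"
  and dual_vec_add: "dual_vec p (m + n) = dual_vec p m + dual_vec p n"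
  and dual_vec_zero: "dual_vec p 0 = 0"
  by (simp_all add: dual_vec_def vec_eq_iff diff_divide_distrib add_divide_distrib)

lemma norm_wave [simp]: "norm (wave l x) = 1"
  by (simp add: wave_def)

lemma wave_add_left: "wave (l + l') x = wave l x * wave l' x"
  and wave_add_right: "wave l (x + y) = wave l x * wave l y"
  and cnj_wave: "cnj (wave l x) = wave (- l) x"
  and wave_zero: "wave 0 x = 1"
  by (simp_all add: wave_def cis_mult cis_cnj inner_add_left inner_add_right distrib_left)

lemma wave_mult_cnj: "wave l x * cnj (wave l' x) = wave (l - l') x"
  using wave_add_left[of l "- l'" x] by (simp add: cnj_wave)

lemma borel_measurable_wave [measurable (raw)]:
  "f \<in> borel_measurable M \<Longrightarrow> g \<in> borel_measurable M \<Longrightarrow> (\<lambda>x. wave (f x) (g x)) \<in> borel_measurable M"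
  unfolding wave_def by (rule borel_measurable_continuous_on[where f = cis]) (auto intro!: continuous_intros)

lemma inner_dual_lattice:
  assumes "\<forall>i. p $ i \<noteq> 0"
  shows "dual_vec p m \<bullet> lattice_vec p n = of_int (\<Sum>i\<in>UNIV. m $ i * n $ i)"
  using assms by (simp add: dual_vec_def lattice_vec_def inner_vec_def)

lemma wave_dual_lattice:
  assumes "\<forall>i. p $ i \<noteq> 0"
  shows "wave (dual_vec p m) (x + lattice_vec p n) = wave (dual_vec p m) x"
  using inner_dual_lattice[OF assms, of m n] cis_multiple_2pi[of "of_int (\<Sum>i\<in>UNIV. m $ i * n $ i)"]
  by (simp only: wave_add_right) (simp add: wave_def del: cis_multiple_2pi of_int_sum)

section \<open>Unfolding integrals over tiles\<close>

lemma nn_integral_lborel_translate: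
  fixes t :: "'a :: euclidean_space"
  assumes [measurable]: "f \<in> borel_measurable borel"
  shows "(\<integral>\<^sup>+x. f (x + t) \<partial>lborel) = (\<integral>\<^sup>+x. f x \<partial>lborel)"
  by (subst (2) lborel_distr_plus[of t, symmetric], subst nn_integral_distr) (simp_all add: add.commute)

text \<open>The translates of a tile are a partition of unity; in this form it can be inserted into
  integrals.\<close>

lemma tile_translate_sum:
  assumes "tile p A"
  shows "(\<integral>\<^sup>+n. indicator A (x + lattice_vec p n) \<partial>count_space UNIV) = 1"
proof -
  have "\<exists>!n. x + lattice_vec p n \<in> A"
    using assms by (simp add: tile_def)
  then obtain n where n: "\<And>m. x + lattice_vec p m \<in> A \<longleftrightarrow> m = n"
    by blast
  have "indicator A (x + lattice_vec p m) = (indicator {n} m :: ennreal)" for m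
    using n by (auto simp: indicator_def)
  then show ?thesis
    by simp
qed

text \<open>Insert the partition of unity given by the translates of \<open>B\<close>, interchange
  sum and integral, and move each translation from \<open>B\<close> to \<open>f\<close>.
  Nonnegativity makes the interchange unconditional.\<close>

lemma nn_integral_tile_sum:
  fixes f :: "real^'n \<Rightarrow> ennreal"
  assumes B: "tile p B" and f [measurable]: "f \<in> borel_measurable borel"
  shows "(\<integral>\<^sup>+x. f x \<partial>lborel)
     = (\<integral>\<^sup>+x. (\<integral>\<^sup>+n. f (x + lattice_vec p n) \<partial>count_space UNIV) * indicator B x \<partial>lborel)"
proof -
  have [measurable]: "B \<in> sets borel"
    using B by (rule tile_sets)
  let ?C = "count_space (UNIV :: (int^'n) set)"
  have "(\<integral>\<^sup>+x. f x \<partial>lborel) = (\<integral>\<^sup>+x. (\<integral>\<^sup>+n. f x * indicator B (x + lattice_vec p n) \<partial>?C) \<partial>lborel)"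
    by (subst nn_integral_cmult) (auto simp: tile_translate_sum[OF B])
  also have "\<dots> = (\<integral>\<^sup>+n. (\<integral>\<^sup>+x. f x * indicator B (x + lattice_vec p n) \<partial>lborel) \<partial>?C)"
    by (rule nn_integral_count_space_nn_integral) auto
  also have "\<dots> = (\<integral>\<^sup>+n. (\<integral>\<^sup>+x. f (x + lattice_vec p (- n)) * indicator B x \<partial>lborel) \<partial>?C)"
  proof (rule nn_integral_cong)
    fix n
    show "(\<integral>\<^sup>+x. f x * indicator B (x + lattice_vec p n) \<partial>lborel)
        = (\<integral>\<^sup>+x. f (x + lattice_vec p (- n)) * indicator B x \<partial>lborel)"
      by (subst nn_integral_lborel_translate[symmetric, of _ "lattice_vec p n"])
        (simp_all add: lattice_vec_minus)
  qed
  also have "\<dots> = (\<integral>\<^sup>+n. (\<integral>\<^sup>+x. f (x + lattice_vec p n) * indicator B x \<partial>lborel) \<partial>?C)"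
    by (rule nn_integral_bij_count_space[of uminus UNIV UNIV]) (auto intro: bij_uminus)
  also have "\<dots> = (\<integral>\<^sup>+x. (\<integral>\<^sup>+n. f (x + lattice_vec p n) * indicator B x \<partial>?C) \<partial>lborel)"
    by (rule nn_integral_count_space_nn_integral[symmetric]) auto
  finally show ?thesis
    by (simp add: nn_integral_multc)
qed

text \<open>Unfolding \<open>f * indicator A\<close> along \<open>B\<close> leaves the periodic
  \<open>f\<close> times the sum of the translates of \<open>indicator A\<close>, which is
  1.\<close>

lemma nn_integral_tile:
  fixes f :: "real^'n \<Rightarrow> ennreal"
  assumes A: "tile p A" and B: "tile p B" and f [measurable]: "f \<in> borel_measurable borel"
    and per: "\<And>x n. f (x + lattice_vec p n) = f x"
  shows "(\<integral>\<^sup>+x. f x * indicator A x \<partial>lborel) = (\<integral>\<^sup>+x. f x * indicator B x \<partial>lborel)"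
proof -
  have [measurable]: "A \<in> sets borel"
    using A by (rule tile_sets)
  show ?thesis
    by (subst nn_integral_tile_sum[OF B])
      (simp_all add: per nn_integral_cmult tile_translate_sum[OF A])
qed

text \<open>Phrased with push-forward measures so that it applies to integrals of complex periodic
  functions without splitting them into nonnegative parts.\<close>

lemma distr_tile:
  assumes A: "tile p A" and B: "tile p B" and g [measurable]: "g \<in> measurable borel N"
    and per: "\<And>x n. g (x + lattice_vec p n) = g x"
  shows "distr (lborel_restr A) N g = distr (lborel_restr B) N g"
proof (rule measure_eqI)
  have [measurable]: "A \<in> sets borel" "B \<in> sets borel"
    using A B by (auto dest: tile_sets)
  fix S assume "S \<in> sets (distr (lborel_restr A) N g)"
  then have [measurable]: "S \<in> sets N"
    by simp
  have "emeasure (distr (lborel_restr C) N g) S = (\<integral>\<^sup>+x. indicator S (g x) * indicator C x \<partial>lborel)"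
    if [measurable]: "C \<in> sets borel" for C
  proof -
    have "emeasure (distr (lborel_restr C) N g) S = emeasure (lborel_restr C) (g -` S)"
      by (subst emeasure_distr) auto
    also have "\<dots> = (\<integral>\<^sup>+x. indicator C x * indicator (g -` S) x \<partial>lborel)"
      using measurable_sets[OF g \<open>S \<in> sets N\<close>] by (intro emeasure_density) auto
    finally show ?thesis
      by (simp add: mult.commute indicator_def vimage_def)
  qed
  then show "emeasure (distr (lborel_restr A) N g) S = emeasure (distr (lborel_restr B) N g) S"
    using A B by (simp add: per nn_integral_tile[OF A B])
qed simp

lemma tile_shift:
  assumes "tile p A"
  shows "tile p {x. x + t \<in> A}"
proof -
  have "{x. x + t \<in> A} = (\<lambda>x. x + t) -` A \<inter> space borel"
    by auto
  also have "\<dots> \<in> sets borel"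
    using tile_sets[OF assms] by measurable
  finally have s: "{x. x + t \<in> A} \<in> sets borel" .
  have "\<exists>!n. (x + t) + lattice_vec p n \<in> A" for x
    using assms by (simp add: tile_def)
  with s show ?thesis
    by (simp add: tile_def ac_simps)
qed

section \<open>The box as a model tile\<close>

definition half_open_box :: "real^'n \<Rightarrow> (real^'n) set" where
  "half_open_box p = {x. \<forall>i. 0 \<le> x $ i \<and> x $ i < p $ i}"

lemma half_open_box_Ex1:
  assumes "(p :: real) > 0"
  shows "\<exists>!n::int. 0 \<le> x + p * of_int n \<and> x + p * of_int n < p"
proof -
  have "0 \<le> x + p * of_int n \<and> x + p * of_int n < p \<longleftrightarrow> n = - \<lfloor>x / p\<rfloor>" for n
  proof -
    have "0 \<le> x + p * of_int n \<and> x + p * of_int n < p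
        \<longleftrightarrow> of_int (- n) \<le> x / p \<and> x / p < of_int (- n) + 1"
      using assms by (auto simp: field_simps)
    also have "\<dots> \<longleftrightarrow> \<lfloor>x / p\<rfloor> = - n"
      by (metis floor_eq_iff)
    finally show ?thesis
      by auto
  qed
  then show ?thesis
    by auto
qed

lemma tile_half_open_box:
  assumes "\<forall>i. p $ i > 0"
  shows "tile p (half_open_box p)"
proof -
  have "half_open_box p = (\<Inter>i. {x. 0 \<le> x $ i} \<inter> {x. x $ i < p $ i})"
    by (auto simp: half_open_box_def)
  also have "\<dots> \<in> sets borel"
    by (intro sets.finite_INT sets.Int borel_closed borel_open closed_Collect_le open_Collect_less
        continuous_intros) auto
  finally have "half_open_box p \<in> sets borel" .
  moreover have "\<exists>!n. x + lattice_vec p n \<in> half_open_box p" for x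
  proof -
    have "\<exists>n. \<forall>i. \<forall>m. (0 \<le> x $ i + p $ i * of_int m \<and> x $ i + p $ i * of_int m < p $ i) \<longleftrightarrow> m = n i"
      using half_open_box_Ex1[of "p $ _" "x $ _"] assms by (intro choice) metis
    then obtain n where "\<And>i m. (0 \<le> x $ i + p $ i * of_int m \<and> x $ i + p $ i * of_int m < p $ i) \<longleftrightarrow> m = n i"
      by auto
    then have "x + lattice_vec p m \<in> half_open_box p \<longleftrightarrow> m = (\<chi> i. n i)" for m
      by (simp add: half_open_box_def lattice_vec_def vec_eq_iff)
    then show ?thesis
      by auto
  qed
  ultimately show ?thesis
    by (simp add: tile_def)
qed

text \<open>Squeezed between the open and the closed box, whose measures agree.\<close>

lemma emeasure_half_open_box:
  fixes p :: "real^'n"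
  assumes "\<forall>i. p $ i > 0"
  shows "emeasure lborel (half_open_box p) = ennreal (\<Prod>i\<in>UNIV. p $ i)"
proof (rule antisym)
  have b: "b \<in> Basis \<Longrightarrow> 0 \<le> p \<bullet> b" for b
    using assms by (auto simp: Basis_vec_def inner_axis less_imp_le)
  have "(\<Prod>b\<in>Basis. p \<bullet> b) = (\<Prod>i\<in>UNIV. p $ i)"
  proof -
    have B: "(Basis :: (real^'n) set) = range (\<lambda>i. axis i 1)"
      by (auto simp: Basis_vec_def)
    show ?thesis
      unfolding B by (subst prod.reindex) (auto simp: inj_on_def axis_eq_axis inner_axis)
  qed
  then have p: "emeasure lborel (box 0 p) = ennreal (\<Prod>i\<in>UNIV. p $ i)"
    "emeasure lborel (cbox 0 p) = ennreal (\<Prod>i\<in>UNIV. p $ i)"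
    using b by (simp_all add: emeasure_lborel_box_eq emeasure_lborel_cbox_eq)
  have s: "half_open_box p \<in> sets lborel"
    using tile_sets[OF tile_half_open_box[OF assms]] by simp
  show "emeasure lborel (half_open_box p) \<le> ennreal (\<Prod>i\<in>UNIV. p $ i)"
    unfolding p(2)[symmetric]
    by (rule emeasure_mono) (auto simp: half_open_box_def mem_box_cart less_imp_le)
  show "ennreal (\<Prod>i\<in>UNIV. p $ i) \<le> emeasure lborel (half_open_box p)"
    unfolding p(1)[symmetric]
    by (rule emeasure_mono[OF _ s]) (auto simp: half_open_box_def mem_box_cart less_imp_le)
qed

lemma emeasure_tile:
  assumes p: "\<forall>i. p $ i > 0" and A: "tile p A"
  shows "emeasure lborel A = ennreal (\<Prod>i\<in>UNIV. p $ i)"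
  using nn_integral_tile[OF A tile_half_open_box[OF p], of "\<lambda>_. 1"] tile_sets[OF A]
    tile_sets[OF tile_half_open_box[OF p]] emeasure_half_open_box[OF p] by simp

text \<open>No integral is evaluated: a shift \<open>t\<close> with
  \<open>dual_vec p n \<bullet> t = 1 / 2\<close> changes the sign of the wave, yet the shifted tile
  is again a tile and yields the same integral. Hence the integral equals its own negative.\<close>

lemma integral_wave_tile_neq_0:
  assumes p: "\<forall>i. p $ i > 0" and A: "tile p A" and "n \<noteq> 0"
  shows "(\<integral>x. wave (dual_vec p n) x \<partial>lborel_restr A) = 0"
proof -
  have p0: "\<forall>i. p $ i \<noteq> 0"
    using p by (metis less_irrefl)
  have [measurable]: "A \<in> sets borel"
    using A by (rule tile_sets)
  obtain i where i: "n $ i \<noteq> 0"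
    using \<open>n \<noteq> 0\<close> by (auto simp: vec_eq_iff)
  \<comment> \<open>Half a wavelength along a coordinate in which \<open>n\<close> is
    nonzero.\<close>
  define t where "t = axis i (p $ i / (2 * of_int (n $ i)))"
  have "dual_vec p n \<bullet> t = 1 / 2"
    using i p0 by (simp add: t_def dual_vec_def inner_axis)
  then have "wave (dual_vec p n) t = -1"
    unfolding wave_def by (simp only:) simp
  then have w: "wave (dual_vec p n) (x + t) = - wave (dual_vec p n) x" for x
    by (simp add: wave_add_right)
  let ?I = "\<lambda>A. \<integral>x. wave (dual_vec p n) x \<partial>lborel_restr A"
  have I: "?I B = (\<integral>x. of_real (indicator B x) * wave (dual_vec p n) x \<partial>lborel)"
    if [measurable]: "B \<in> sets borel" for B
    by (subst integral_density[where g = "\<lambda>x. indicator B x", simplified ennreal_indicator])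
      (auto simp: scaleR_conv_of_real)
  let ?B = "{x. x + t \<in> A}"
  \<comment> \<open>Each integral is that of the identity against the push-forward under the wave, a
    measure common to all tiles.\<close>
  have "?I A = (\<integral>z. z \<partial>distr (lborel_restr A) borel (wave (dual_vec p n)))"
    by (subst integral_distr) simp_all
  also have "\<dots> = (\<integral>z. z \<partial>distr (lborel_restr ?B) borel (wave (dual_vec p n)))"
    by (subst distr_tile[OF A tile_shift[OF A]]) (auto simp: wave_dual_lattice[OF p0])
  also have "\<dots> = ?I ?B"
    by (subst integral_distr) simp_all
  also have "\<dots> = (\<integral>x. of_real (indicator A (x + t)) * wave (dual_vec p n) x \<partial>lborel)"
    using tile_sets[OF tile_shift[OF A]] by (subst I) (auto simp: indicator_def)
  also have "\<dots> = (\<integral>x. - (of_real (indicator A (x + t)) * wave (dual_vec p n) (x + t)) \<partial>lborel)"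
    by (simp add: w)
  also have "\<dots> = - (\<integral>x. of_real (indicator A (x + t)) * wave (dual_vec p n) (x + t) \<partial>lborel)"
    by (rule integral_minus)
  also have "(\<integral>x. of_real (indicator A (x + t)) * wave (dual_vec p n) (x + t) \<partial>lborel) = ?I A"
    by (subst I, simp, subst (2) lborel_distr_plus[of t, symmetric], subst integral_distr)
      (auto simp: add.commute)
  finally show ?thesis
    by simp
qed

lemma integral_wave_tile:
  assumes p: "\<forall>i. p $ i > 0" and A: "tile p A"
  shows "(\<integral>x. wave (dual_vec p m) x * cnj (wave (dual_vec p n) x) \<partial>lborel_restr A)
     = (if m = n then of_real (\<Prod>i\<in>UNIV. p $ i) else 0)"
proof (cases "m = n")
  case True
  have [measurable]: "A \<in> sets borel"
    using A by (rule tile_sets)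
  have "emeasure (lborel_restr A) UNIV = emeasure lborel A"
    by (simp add: emeasure_density)
  then have "measure (lborel_restr A) UNIV = (\<Prod>i\<in>UNIV. p $ i)"
    using emeasure_tile[OF p A] p by (simp add: measure_def prod_nonneg less_imp_le)
  then show ?thesis
    using True by (simp add: wave_mult_cnj wave_zero scaleR_conv_of_real)
next
  case False
  then show ?thesis
    using integral_wave_tile_neq_0[OF p A, of "m - n"] by (simp add: wave_mult_cnj dual_vec_diff)
qed

subsection \<open>Completeness of exponentials on a tile\<close>

text \<open>Realises the quotient by the lattice inside a compact set; the exponentials become
  polynomials in the coordinates and their conjugates.\<close>

definition torus_map :: "real^'n \<Rightarrow> real^'n \<Rightarrow> complex^'n" where
  "torus_map p x = (\<chi> i. cis (2 * pi * (x $ i / p $ i)))"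

definition torus :: "(complex^'n) set" where
  "torus = {z. \<forall>i. norm (z $ i) = 1}"

lemma continuous_torus_map: "continuous_on S (torus_map p)"
  unfolding torus_map_def divide_inverse by (intro continuous_intros)

lemma torus_map_measurable [measurable]: "torus_map p \<in> borel_measurable borel"
  by (intro borel_measurable_continuous_onI continuous_torus_map)

lemma torus_map_in_torus: "torus_map p x \<in> torus"
  by (simp add: torus_def torus_map_def)

lemma closed_torus: "closed (torus :: (complex^'n) set)"
proof -
  have "torus = (\<Inter>i. {z :: complex^'n. norm (z $ i) = 1})"
    by (auto simp: torus_def)
  also have "closed \<dots>"
    by (intro closed_INT ballI closed_Collect_eq continuous_intros)
  finally show ?thesis .
qed

lemma compact_torus: "compact (torus :: (complex^'n) set)"
proof -
  have "norm z \<le> CARD('n)" if "z \<in> torus" for z :: "complex^'n"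
  proof -
    have "norm z \<le> (\<Sum>i\<in>UNIV. norm (z $ i))"
      unfolding norm_vec_def by (rule L2_set_le_sum) simp
    also have "\<dots> = CARD('n)"
      using that by (simp add: torus_def)
    finally show ?thesis .
  qed
  then have "bounded (torus :: (complex^'n) set)"
    by (auto simp: bounded_iff)
  then show ?thesis
    using closed_torus by (simp add: compact_eq_bounded_closed)
qed

section \<open>A Borel inverse of the torus map on a tile\<close>

lemma torus_map_eqD:
  assumes p: "\<forall>i. p $ i > 0" and eq: "torus_map p y = torus_map p x"
  shows "\<exists>n. y = x + lattice_vec p n"
proof -
  have "\<exists>n::int. y $ i = x $ i + p $ i * of_int n" for i
  proof -
    have "cis (2 * pi * (y $ i / p $ i)) = cis (2 * pi * (x $ i / p $ i))"
      using eq by (simp add: torus_map_def vec_eq_iff)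
    then obtain n :: int where "2 * pi * (y $ i / p $ i) = 2 * pi * (x $ i / p $ i) + 2 * pi * n"
      using sin_cos_eq_iff by (auto simp: complex_eq_iff)
    then have "2 * pi * (y $ i / p $ i) = 2 * pi * (x $ i / p $ i + n)"
      by (simp add: distrib_left)
    then have "y $ i / p $ i = x $ i / p $ i + n"
      by (simp only: mult_cancel_left) simp
    moreover have "p $ i \<noteq> 0"
      using p by (metis less_irrefl)
    ultimately show ?thesis
      by (intro exI[of _ n]) (simp add: field_simps)
  qed
  then obtain n where "\<And>i. y $ i = x $ i + p $ i * of_int (n i)"
    by metis
  then show ?thesis
    by (intro exI[of _ "\<chi> i. n i"]) (simp add: vec_eq_iff lattice_vec_def)
qed

text \<open>Continuity can fail only on the nonnegative real axis, where the value is 0, so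
  multiplying by the indicator of the complement changes nothing.\<close>

lemma Arg2pi_measurable [measurable]: "Arg2pi \<in> borel_measurable borel"
proof -
  have "(\<lambda>z. indicator (- \<real>\<^sub>\<ge>\<^sub>0) z *\<^sub>R Arg2pi z) \<in> borel_measurable borel"
  proof (rule borel_measurable_continuous_on_indicator)
    show "- \<real>\<^sub>\<ge>\<^sub>0 \<in> sets (borel :: complex measure)"
      using closed_nonneg_Reals_complex by auto
    show "continuous_on (- \<real>\<^sub>\<ge>\<^sub>0) Arg2pi"
      by (intro continuous_at_imp_continuous_on ballI continuous_at_Arg2pi) auto
  qed
  also have "(\<lambda>z. indicator (- \<real>\<^sub>\<ge>\<^sub>0) z *\<^sub>R Arg2pi z) = Arg2pi"
  proof
    fix z :: complex
    show "indicator (- \<real>\<^sub>\<ge>\<^sub>0) z *\<^sub>R Arg2pi z = Arg2pi z"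
      using Arg2pi_eq_0[of z] by (auto simp: indicator_def complex_nonneg_Reals_iff complex_is_Real_iff)
  qed
  finally show ?thesis .
qed

text \<open>A Borel section of \<open>torus_map\<close> for positive \<open>p\<close>, with values
  in \<open>half_open_box p\<close>; composing with \<open>tile_proj\<close> makes it a section into
  a given tile.\<close>

definition torus_inv :: "real^'n \<Rightarrow> complex^'n \<Rightarrow> real^'n" where
  "torus_inv p z = (\<chi> i. p $ i * (Arg2pi (z $ i) / (2 * pi)))"

lemma torus_map_inv:
  assumes p: "\<forall>i. p $ i > 0" and z: "z \<in> torus"
  shows "torus_map p (torus_inv p z) = z"
proof -
  have "cis (Arg2pi (z $ i)) = z $ i" for i
    using Arg2pi_eq[of "z $ i"] z by (simp add: torus_def cis_conv_exp)
  moreover have "2 * pi * (p $ i * (Arg2pi (z $ i) / (2 * pi)) / p $ i) = Arg2pi (z $ i)" for i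
    using p[rule_format, of i] by simp
  ultimately show ?thesis
    unfolding torus_map_def torus_inv_def by (simp add: vec_eq_iff del: times_divide_eq_right times_divide_eq_left)
qed

lemma borel_measurable_vec_lambda:
  fixes f :: "'a \<Rightarrow> 'n :: finite \<Rightarrow> real"
  assumes "\<And>i. (\<lambda>x. f x i) \<in> borel_measurable M"
  shows "(\<lambda>x. \<chi> i. f x i) \<in> borel_measurable M"
  by (subst borel_measurable_euclidean_space) (auto simp: Basis_vec_def inner_axis assms)

lemma torus_inv_measurable [measurable]:
  fixes p :: "real^'n"
  shows "torus_inv p \<in> borel_measurable borel"
proof -
  have [measurable]: "(\<lambda>z :: complex^'n. z $ i) \<in> borel_measurable borel" for i :: 'n
    by (intro borel_measurable_continuous_onI continuous_intros)
  show ?thesis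
    unfolding torus_inv_def by (intro borel_measurable_vec_lambda) measurable
qed

definition tile_proj :: "real^'n \<Rightarrow> (real^'n) set \<Rightarrow> real^'n \<Rightarrow> real^'n" where
  "tile_proj p A x = x + lattice_vec p (THE n. x + lattice_vec p n \<in> A)"

lemma tile_proj_in:
  assumes "tile p A"
  shows "tile_proj p A x \<in> A"
  using theI'[of "\<lambda>n. x + lattice_vec p n \<in> A"] assms by (simp add: tile_def tile_proj_def)

lemma tile_proj_eq:
  assumes A: "tile p A" and x: "x + lattice_vec p n \<in> A"
  shows "tile_proj p A x = x + lattice_vec p n"
proof -
  have "(THE n. x + lattice_vec p n \<in> A) = n"
    using A x by (intro the1_equality) (auto simp: tile_def)
  then show ?thesis
    by (simp add: tile_proj_def)
qed

text \<open>There are countably many lattice vectors, so a preimage is a countable union of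
  translated Borel sets.\<close>

lemma tile_proj_measurable:
  fixes p :: "real^'n"
  assumes A: "tile p A"
  shows "tile_proj p A \<in> borel_measurable borel"
proof (rule measurableI)
  fix S :: "(real^'n) set" assume S [measurable]: "S \<in> sets borel"
  have [measurable]: "A \<in> sets borel"
    using A by (rule tile_sets)
  have "tile_proj p A -` S \<inter> space borel = (\<Union>n. (\<lambda>x. x + lattice_vec p n) -` (A \<inter> S) \<inter> space borel)"
  proof (intro equalityI subsetI)
    fix x assume x: "x \<in> tile_proj p A -` S \<inter> space borel"
    with tile_proj_in[OF A, of x]
    show "x \<in> (\<Union>n. (\<lambda>x. x + lattice_vec p n) -` (A \<inter> S) \<inter> space borel)"
      by (auto simp: tile_proj_def)
  qed (auto simp: tile_proj_eq[OF A])
  also have "\<dots> \<in> sets borel"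
    by (intro sets.countable_UN' measurable_sets[where A = borel]) auto
  finally show "tile_proj p A -` S \<inter> space borel \<in> sets borel" .
qed simp

lemma lin_comb_wave_mult:
  assumes "f \<in> lin_comb UNIV (\<lambda>n. wave (dual_vec p n))" "g \<in> lin_comb UNIV (\<lambda>n. wave (dual_vec p n))"
  shows "(\<lambda>x. f x * g x) \<in> lin_comb UNIV (\<lambda>n. wave (dual_vec p n))"
proof -
  note C = csubspace_lin_comb[of UNIV "\<lambda>n. wave (dual_vec p n)"]
  obtain J u K v where f: "finite J" "f = (\<lambda>x. \<Sum>m\<in>J. u m * wave (dual_vec p m) x)"
    and g: "finite K" "g = (\<lambda>x. \<Sum>n\<in>K. v n * wave (dual_vec p n) x)"
    using assms by (elim lin_combE) blast
  have "(\<lambda>x. f x * g x) = (\<lambda>x. \<Sum>m\<in>J. \<Sum>n\<in>K. (u m * v n) * wave (dual_vec p (m + n)) x)"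
    by (simp add: f g sum_product dual_vec_add wave_add_left ac_simps)
  also have "\<dots> \<in> lin_comb UNIV (\<lambda>n. wave (dual_vec p n))"
    by (intro csubspace_sum[OF C] csubspace_cmult[OF C] lin_comb_base) auto
  finally show ?thesis .
qed

text \<open>Real and imaginary parts of the coordinates are combinations of waves and separate
  points, so the real form of Stone-Weierstrass suffices. The predicate \<open>P\<close> records
  what must survive sums and products: continuity, and pulling back to a combination of
  waves.\<close>

lemma torus_Stone_Weierstrass:
  fixes \<phi> :: "complex^'n \<Rightarrow> real"
  assumes "continuous_on UNIV \<phi>" "e > 0"
  obtains f where "continuous_on torus f" "\<And>z. z \<in> torus \<Longrightarrow> \<bar>\<phi> z - f z\<bar> < e"
    "(\<lambda>x. complex_of_real (f (torus_map p x))) \<in> lin_comb UNIV (\<lambda>n. wave (dual_vec p n))"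
proof -
  let ?W = "lin_comb UNIV (\<lambda>n. wave (dual_vec p n))"
  note C = csubspace_lin_comb[of UNIV "\<lambda>n. wave (dual_vec p n)"]
  define P where "P f \<longleftrightarrow> continuous_on torus f \<and> (\<lambda>x. complex_of_real (f (torus_map p x))) \<in> ?W" for f
  have w: "(\<lambda>x. wave (dual_vec p n) x) \<in> ?W" for n
    by (rule lin_comb_base) simp
  have ax: "wave (dual_vec p (axis i 1)) x = torus_map p x $ i" for i x
    by (auto simp: wave_def torus_map_def dual_vec_def inner_vec_def axis_def if_distrib
        if_distribR sum.If_cases cong: if_cong)
  have ax': "wave (dual_vec p (- axis i 1)) x = cnj (torus_map p x $ i)" for i x
    by (simp add: ax[symmetric] dual_vec_minus cnj_wave)
  have PRe: "P (\<lambda>z. Re (z $ i))" for i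
  proof -
    have "(\<lambda>x. complex_of_real (Re (torus_map p x $ i)))
        = (\<lambda>x. (1/2) * (wave (dual_vec p (axis i 1)) x + wave (dual_vec p (- axis i 1)) x))"
      by (simp add: fun_eq_iff ax ax' complex_add_cnj)
    also have "\<dots> \<in> ?W"
      by (intro csubspace_cmult[OF C] csubspace_add[OF C] w)
    finally show ?thesis
      by (auto simp: P_def intro!: continuous_intros)
  qed
  have PIm: "P (\<lambda>z. Im (z $ i))" for i
  proof -
    have "(\<lambda>x. complex_of_real (Im (torus_map p x $ i)))
        = (\<lambda>x. (-\<i>/2) * (wave (dual_vec p (axis i 1)) x - wave (dual_vec p (- axis i 1)) x))"
      by (simp add: fun_eq_iff ax ax' complex_eq_iff)
    also have "\<dots> \<in> ?W"
      by (intro csubspace_cmult[OF C] csubspace_diff[OF C] w)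
    finally show ?thesis
      by (auto simp: P_def intro!: continuous_intros)
  qed
  have "\<exists>g. P g \<and> (\<forall>z\<in>torus. \<bar>\<phi> z - g z\<bar> < e)"
  proof (rule Stone_Weierstrass_HOL[OF compact_torus])
    fix c :: real
    have "(\<lambda>x. of_real c * wave (dual_vec p 0) x) \<in> ?W"
      by (intro csubspace_cmult[OF C] w)
    then show "P (\<lambda>z. c)"
      by (simp add: P_def dual_vec_zero wave_zero)
  next
    fix z z' :: "complex^'n" assume "z \<in> torus \<and> z' \<in> torus \<and> z \<noteq> z'"
    then obtain i where "Re (z $ i) \<noteq> Re (z' $ i) \<or> Im (z $ i) \<noteq> Im (z' $ i)"
      by (auto simp: vec_eq_iff complex_eq_iff)
    then show "\<exists>f. P f \<and> f z \<noteq> f z'"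
      using PRe[of i] PIm[of i] by blast
  next
    fix f g assume "P f \<and> P g"
    then show "P (\<lambda>z. f z + g z)" "P (\<lambda>z. f z * g z)"
      using csubspace_add[OF C, of "\<lambda>x. complex_of_real (f (torus_map p x))" "\<lambda>x. complex_of_real (g (torus_map p x))"]
        lin_comb_wave_mult[of "\<lambda>x. complex_of_real (f (torus_map p x))" p "\<lambda>x. complex_of_real (g (torus_map p x))"]
      by (auto simp: P_def intro!: continuous_intros)
  qed (use assms in \<open>auto simp: P_def intro: continuous_on_subset\<close>)
  then show ?thesis
    using that by (auto simp: P_def)
qed

lemma open_indicator_limit:
  fixes U :: "'a :: metric_space set"
  assumes "open U"
  obtains \<phi> :: "nat \<Rightarrow> 'a \<Rightarrow> real" where "\<And>n. continuous_on UNIV (\<phi> n)"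
    "\<And>n x. 0 \<le> \<phi> n x" "\<And>n x. \<phi> n x \<le> 1" "\<And>x. (\<lambda>n. \<phi> n x) \<longlonglongrightarrow> indicator U x"
proof (cases "U = UNIV")
  \<comment> \<open>Treated apart because \<open>infdist\<close> to the empty set is 0 by
    convention, which would make the sequence below vanish.\<close>
  case True
  then show ?thesis
    using that[of "\<lambda>_ _. 1"] by simp
next
  case False
  have cl: "closed (- U)" "- U \<noteq> {}"
    using assms False by auto
  have "(\<lambda>n. min 1 (real n * infdist x (- U))) \<longlonglongrightarrow> indicator U x" for x
  proof (cases "x \<in> U")
    case True
    then have d: "infdist x (- U) > 0"
      using infdist_pos_not_in_closed[OF cl] by simp
    have "eventually (\<lambda>n. min 1 (real n * infdist x (- U)) = 1) sequentially"
      using eventually_ge_at_top[of "nat \<lceil>1 / infdist x (- U)\<rceil>"]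
    proof eventually_elim
      case (elim n)
      then have "1 / infdist x (- U) \<le> real n"
        by linarith
      then show ?case
        using d by (simp add: field_simps)
    qed
    then show ?thesis
      using True by (simp add: tendsto_eventually)
  next
    case False
    then show ?thesis
      by simp
  qed
  then show ?thesis
    by (intro that[of "\<lambda>n x. min 1 (real n * infdist x (- U))"])
      (auto intro!: continuous_intros simp: infdist_nonneg)
qed

text \<open>
  \<open>torus_map\<close> is a Borel isomorphism of the tile onto the torus. It turns the exponentials into
  continuous functions separating points, so Stone--Weierstrass applies.
\<close>

theorem wave_complete_tile:
  fixes p :: "real^'n"
  assumes p: "\<forall>i. p $ i > 0" and A: "tile p A"
  shows "L2 (lborel_restr A) \<subseteq> L2_closure (lborel_restr A) (lin_comb UNIV (\<lambda>n. wave (dual_vec p n)))"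
proof -
  let ?M = "lborel_restr A" and ?W = "lin_comb UNIV (\<lambda>n. wave (dual_vec p n))"
  \<comment> \<open>\<open>N\<close> is the measure carried over to the torus, and \<open>V\<close>
    the functions there that pull back to combinations of waves. Density is shown for
    \<open>N\<close> and \<open>V\<close>, where continuous functions can be approximated uniformly,
    and then pulled back.\<close>
  define N where "N = distr ?M borel (torus_map p)"
  define V where "V = {g \<in> borel_measurable borel. (\<lambda>x. g (torus_map p x)) \<in> ?W}"
  have [measurable]: "A \<in> sets borel" "tile_proj p A \<in> borel_measurable borel"
    using A by (auto intro: tile_sets tile_proj_measurable)
  note C = csubspace_lin_comb[of UNIV "\<lambda>n. wave (dual_vec p n)"]
  have "emeasure ?M UNIV = emeasure lborel A"
    by (simp add: emeasure_density)
  then have finM: "finite_measure ?M"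
    using emeasure_tile[OF p A] by (intro finite_measureI) simp
  then interpret M: finite_measure ?M .
  have finN: "finite_measure N"
    unfolding N_def by (rule M.finite_measure_distr) simp
  have sqN: "L2_sqnorm N g = L2_sqnorm ?M (\<lambda>x. g (torus_map p x))"
    if [measurable]: "g \<in> borel_measurable borel" for g
    unfolding L2_sqnorm_def N_def by (subst integral_distr) auto
  have L2N: "g \<in> L2 N \<longleftrightarrow> (\<lambda>x. g (torus_map p x)) \<in> L2 ?M"
    if [measurable]: "g \<in> borel_measurable borel" for g
    unfolding L2_def N_def by (auto simp: integrable_distr_eq)
  have WL2: "?W \<subseteq> L2 ?M"
    by (intro lin_comb_subset csubspace_L2 L2I) auto
  then have VL2: "V \<subseteq> L2 N"
    by (auto simp: V_def L2N)
  have V: "csubspace V"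
    unfolding csubspace_def V_def
    using csubspace_add[OF C] csubspace_cmult[OF C] csubspace_zero[OF C] by auto
  have "L2 N \<subseteq> L2_closure N V"
  proof (rule L2_closure_borel[OF finN _ VL2 V])
    fix U :: "(complex^'n) set" assume U: "open U"
    obtain \<phi> where \<phi>: "\<And>n. continuous_on UNIV (\<phi> n)" "\<And>n x. (0::real) \<le> \<phi> n x" "\<And>n x. \<phi> n x \<le> 1"
      and lim: "\<And>x. (\<lambda>n. \<phi> n x) \<longlonglongrightarrow> indicator U x"
      using open_indicator_limit[OF U] by metis
    have [measurable]: "\<phi> n \<in> borel_measurable borel" for n
      using \<phi>(1) by (rule borel_measurable_continuous_onI)
    have int: "integrable N (\<lambda>z. (1::real)\<^sup>2)"
      by (simp add: finite_measure.integrable_const[OF finN])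
    show "(indicator U :: complex^'n \<Rightarrow> complex) \<in> L2_closure N V"
    proof (rule L2_closure_dominated[OF VL2 _ _ int])
      show "indicator U \<in> borel_measurable N"
        using U by (simp add: N_def borel_open)
      show "norm (complex_of_real (\<phi> n z)) \<le> 1" for n z
        using \<phi> by simp
      have "(indicator U z :: complex) = of_real (indicator U z)" for z
        by (simp add: indicator_def)
      then show "AE z in N. (\<lambda>n. complex_of_real (\<phi> n z)) \<longlonglongrightarrow> indicator U z"
        using lim by (auto intro!: AE_I2 tendsto_of_real)
      fix n
      show "(\<lambda>z. complex_of_real (\<phi> n z)) \<in> L2_closure N V"
      proof (rule L2_closureI)
        show "(\<lambda>z. complex_of_real (\<phi> n z)) \<in> L2 N"
        proof (rule L2I, goal_cases)
          case 2
          show ?case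
            by (rule Bochner_Integration.integrable_bound[OF int])
              (use \<phi> in \<open>auto simp: N_def abs_square_le_1\<close>)
        qed (simp add: N_def)
        fix e :: real assume "e > 0"
        \<comment> \<open>The summand 1 keeps the divisor positive and makes the final estimate
          strict.\<close>
        define m where "m = measure ?M UNIV + 1"
        have m: "m > 0"
          by (simp add: m_def add_nonneg_pos)
        then have "sqrt (e / m) > 0"
          using \<open>e > 0\<close> by simp
        with \<phi>(1)[of n] obtain f where f: "continuous_on torus f"
          and le: "\<And>z. z \<in> torus \<Longrightarrow> \<bar>\<phi> n z - f z\<bar> < sqrt (e / m)"
          and fW: "(\<lambda>x. complex_of_real (f (torus_map p x))) \<in> ?W"
          by (rule torus_Stone_Weierstrass[where p = p]) blast
        \<comment> \<open>The approximant is continuous on the torus only; its extension by 0 is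
          Borel on the whole space.\<close>
        define g where "g z = complex_of_real (indicator torus z *\<^sub>R f z)" for z
        have "(\<lambda>z. indicator torus z *\<^sub>R f z) \<in> borel_measurable borel"
          using closed_torus f by (intro borel_measurable_continuous_on_indicator) (auto intro: borel_closed)
        then have [measurable]: "g \<in> borel_measurable borel"
          unfolding g_def by (rule measurable_compose) simp
        have g_eq: "g (torus_map p x) = of_real (f (torus_map p x))" for x
          by (simp add: g_def torus_map_in_torus)
        have "L2_sqnorm N (\<lambda>z. complex_of_real (\<phi> n z) - g z)
            = (\<integral>x. \<bar>\<phi> n (torus_map p x) - f (torus_map p x)\<bar>\<^sup>2 \<partial>?M)"
          by (subst sqN) (simp_all add: L2_sqnorm_def g_eq flip: of_real_diff)
        also have "\<dots> \<le> (\<integral>x. e / m \<partial>?M)"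
        proof (rule integral_mono')
          fix x
          have "\<bar>\<phi> n (torus_map p x) - f (torus_map p x)\<bar>\<^sup>2 \<le> (sqrt (e / m))\<^sup>2"
            using le[OF torus_map_in_torus, of p x] by (intro power_mono) auto
          then show "\<bar>\<phi> n (torus_map p x) - f (torus_map p x)\<bar>\<^sup>2 \<le> e / m"
            using \<open>e > 0\<close> m by simp
        qed (use \<open>e > 0\<close> m in auto)
        also have "\<dots> = e * ((m - 1) / m)"
          by (simp add: m_def)
        also have "\<dots> < e"
          using \<open>e > 0\<close> m by (simp add: field_simps)
        finally show "\<exists>g\<in>V. L2_sqnorm N (\<lambda>z. complex_of_real (\<phi> n z) - g z) < e"
          using fW by (intro bexI[of _ g]) (simp_all add: V_def g_eq)
      qed
    qed
  qed (simp add: N_def)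
  note dense = this
  show ?thesis
  proof
    fix G assume G: "G \<in> L2 ?M"
    then have [measurable]: "G \<in> borel_measurable borel"
      using L2_measurable[OF G] by simp
    \<comment> \<open>\<open>G\<close> transported to the torus. It pulls back to \<open>G\<close>
      on \<open>A\<close> only, which is enough because \<open>A\<close> carries the
      measure.\<close>
    define H where "H z = G (tile_proj p A (torus_inv p z))" for z
    have [measurable]: "H \<in> borel_measurable borel"
      unfolding H_def by measurable
    have HG: "H (torus_map p x) = G x" if "x \<in> A" for x
    proof -
      have "torus_map p (torus_inv p (torus_map p x)) = torus_map p x"
        by (rule torus_map_inv[OF p torus_map_in_torus])
      from torus_map_eqD[OF p this[symmetric]] obtain n
        where "x = torus_inv p (torus_map p x) + lattice_vec p n"
        by blast
      then have "tile_proj p A (torus_inv p (torus_map p x)) = x"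
        using tile_proj_eq[OF A, of "torus_inv p (torus_map p x)" n] that by simp
      then show ?thesis
        by (simp add: H_def)
    qed
    have AE: "AE x in ?M. x \<in> A"
      by (subst AE_density) (auto simp: indicator_def)
    show "G \<in> L2_closure ?M ?W"
    proof (rule L2_closureI[OF G])
      fix e :: real assume "e > 0"
      have "integrable ?M (\<lambda>x. (norm (H (torus_map p x)))\<^sup>2) \<longleftrightarrow> integrable ?M (\<lambda>x. (norm (G x))\<^sup>2)"
        by (rule integrable_cong_AE) (use AE in \<open>auto simp: HG elim!: AE_mp\<close>)
      then have "H \<in> L2 N"
        using L2_integrable[OF G] by (subst L2N) (auto intro!: L2I)
      then have "H \<in> L2_closure N V"
        using dense by blast
      then obtain g where g: "g \<in> V" "L2_sqnorm N (\<lambda>z. H z - g z) < e"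
        using \<open>e > 0\<close> by (rule L2_closureE)
      then have [measurable]: "g \<in> borel_measurable borel"
        by (simp add: V_def)
      have "L2_sqnorm ?M (\<lambda>x. G x - g (torus_map p x)) = L2_sqnorm ?M (\<lambda>x. H (torus_map p x) - g (torus_map p x))"
        by (rule L2_sqnorm_cong_AE) (use AE in \<open>auto simp: HG elim!: AE_mp\<close>)
      also have "\<dots> = L2_sqnorm N (\<lambda>z. H z - g z)"
        by (subst sqN) auto
      finally show "\<exists>g\<in>?W. L2_sqnorm ?M (\<lambda>x. G x - g x) < e"
        using g by (intro bexI[of _ "\<lambda>x. g (torus_map p x)"]) (auto simp: V_def)
    qed
  qed
qed

subsection \<open>Plancherel's theorem\<close>

text \<open>Orthogonality and density deliver bounds for finite partial sums; this turns them into
  the exact value of the series.\<close>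

lemma nn_integral_count_space_eq_real:
  fixes f :: "'i \<Rightarrow> real"
  assumes nonneg: "\<And>i. f i \<ge> 0" and le: "\<And>J. finite J \<Longrightarrow> sum f J \<le> S"
    and ge: "\<And>e. e > 0 \<Longrightarrow> \<exists>J. finite J \<and> S - e \<le> sum f J"
  shows "(\<integral>\<^sup>+i. ennreal (f i) \<partial>count_space UNIV) = ennreal S"
proof -
  have summ: "Infinite_Set_Sum.abs_summable_on f UNIV"
    by (rule abs_summable_finite_sumsI[where B = S]) (use nonneg le in auto)
  then have s: "f summable_on UNIV"
    using nonneg by (simp add: abs_summable_equivalent[symmetric])
  have "infsum f UNIV = S"
  proof (rule antisym)
    show "infsum f UNIV \<le> S"
      using s le by (intro infsum_le_finite_sums) auto
    show "S \<le> infsum f UNIV"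
    proof (rule field_le_epsilon)
      fix e :: real assume "e > 0"
      then obtain J where "finite J" "S - e \<le> sum f J"
        using ge by blast
      moreover have "sum f J \<le> infsum f UNIV"
        using s nonneg \<open>finite J\<close> by (intro finite_sum_le_infsum) auto
      ultimately show "S \<le> infsum f UNIV + e"
        by simp
    qed
  qed
  then show ?thesis
    using nn_integral_conv_infsetsum[OF summ] nonneg infsetsum_infsum[OF summ] by simp
qed

text \<open>The expansion formula for orthonormal families serves twice: the optimal coefficients
  give Bessel's inequality, and coefficients supplied by the density of the waves give the reverse
  up to \<open>\<epsilon>\<close>. The volume appears because the waves are not normalised.\<close>

lemma Parseval_tile:
  fixes p :: "real^'n"
  assumes p: "\<forall>i. p $ i > 0" and A: "tile p A" and G: "G \<in> L2 (lborel_restr A)"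
  shows "(\<integral>\<^sup>+n. ennreal ((norm (\<integral>x. G x * cnj (wave (dual_vec p n) x) \<partial>lborel_restr A))\<^sup>2) \<partial>count_space UNIV)
     = ennreal ((\<Prod>i\<in>UNIV. p $ i) * L2_sqnorm (lborel_restr A) G)"
proof -
  let ?M = "lborel_restr A"
  define v where "v = (\<Prod>i\<in>UNIV. p $ i)"
  define s where "s = complex_of_real (1 / sqrt v)"
  define c where "c n = (\<integral>x. G x * cnj (wave (dual_vec p n) x) \<partial>?M)" for n
  define e where "e n x = s * wave (dual_vec p n) x" for n x
  have v: "v > 0"
    unfolding v_def using p by (intro prod_pos) auto
  have s: "s * cnj s = of_real (1 / v)" "s \<noteq> 0" "(norm s)\<^sup>2 = 1 / v"
    using v by (simp_all add: s_def flip: of_real_mult)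
      (simp_all add: norm_divide power_divide)
  have [measurable]: "A \<in> sets borel"
    using A by (rule tile_sets)
  have "emeasure ?M UNIV = emeasure lborel A"
    by (simp add: emeasure_density)
  then interpret finite_measure ?M
    using emeasure_tile[OF p A] by (intro finite_measureI) simp
  have w: "wave l \<in> L2 ?M" for l
    by (rule L2I) auto
  have e: "e n \<in> L2 ?M" for n
    unfolding e_def by (intro L2_cmult w)
  have ortho: "(\<integral>x. e m x * cnj (e n x) \<partial>?M) = (if m = n then 1 else 0)" for m n
  proof -
    have "(\<integral>x. e m x * cnj (e n x) \<partial>?M)
        = (\<integral>x. (s * cnj s) * (wave (dual_vec p m) x * cnj (wave (dual_vec p n) x)) \<partial>?M)"
      by (simp add: e_def mult_ac)
    also have "\<dots> = (s * cnj s) * (if m = n then of_real v else 0)"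
      by (subst integral_mult_right_zero) (simp only: integral_wave_tile[OF p A] v_def)
    finally show ?thesis
      using v by (simp add: s)
  qed
  have ce: "(\<integral>x. G x * cnj (e n x) \<partial>?M) = cnj s * c n" for n
  proof -
    have "(\<integral>x. G x * cnj (e n x) \<partial>?M) = (\<integral>x. cnj s * (G x * cnj (wave (dual_vec p n) x)) \<partial>?M)"
      by (simp add: e_def mult_ac)
    then show ?thesis
      by (simp only: c_def integral_mult_right_zero)
  qed
  have expand: "L2_sqnorm ?M (\<lambda>x. G x - (\<Sum>n\<in>J. u n * e n x))
      = L2_sqnorm ?M G - (\<Sum>n\<in>J. (norm (cnj s * c n))\<^sup>2) + (\<Sum>n\<in>J. (norm (u n - cnj s * c n))\<^sup>2)"
    if "finite J" for J u
    using L2_sqnorm_orthonormal[OF that G, of e u] e ortho by (simp add: ce)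
  have nc: "(norm (cnj s * c n))\<^sup>2 = (norm (c n))\<^sup>2 / v" for n
    using s(3) by (simp add: norm_mult power_mult_distrib)
  have "(\<integral>\<^sup>+n. ennreal ((norm (c n))\<^sup>2) \<partial>count_space UNIV) = ennreal (v * L2_sqnorm ?M G)"
  proof (rule nn_integral_count_space_eq_real)
    fix J :: "(int^'n) set" assume J: "finite J"
    have "0 \<le> L2_sqnorm ?M (\<lambda>x. G x - (\<Sum>n\<in>J. (cnj s * c n) * e n x))"
      by (rule L2_sqnorm_nonneg)
    also have "\<dots> = L2_sqnorm ?M G - (\<Sum>n\<in>J. (norm (c n))\<^sup>2) / v"
      by (subst expand[OF J]) (simp add: nc sum_divide_distrib)
    finally show "(\<Sum>n\<in>J. (norm (c n))\<^sup>2) \<le> v * L2_sqnorm ?M G"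
      using v by (simp add: field_simps)
  next
    fix \<epsilon> :: real assume "\<epsilon> > 0"
    have "G \<in> L2_closure ?M (lin_comb UNIV (\<lambda>n. wave (dual_vec p n)))"
      using wave_complete_tile[OF p A] G by blast
    then obtain g where g: "g \<in> lin_comb UNIV (\<lambda>n. wave (dual_vec p n))"
        "L2_sqnorm ?M (\<lambda>x. G x - g x) < \<epsilon> / v"
      using \<open>\<epsilon> > 0\<close> v by (elim L2_closureE[where e = "\<epsilon> / v"]) auto
    then obtain J u where J: "finite J" "g = (\<lambda>x. \<Sum>n\<in>J. u n * wave (dual_vec p n) x)"
      by (elim lin_combE) blast
    have "L2_sqnorm ?M G - (\<Sum>n\<in>J. (norm (c n))\<^sup>2) / v
        \<le> L2_sqnorm ?M (\<lambda>x. G x - (\<Sum>n\<in>J. (u n / s) * e n x))"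
      by (subst expand[OF J(1)]) (simp add: nc sum_divide_distrib sum_nonneg)
    also have "\<dots> < \<epsilon> / v"
      using g(2) s(2) by (simp add: J(2) e_def)
    finally have "v * (L2_sqnorm ?M G - (\<Sum>n\<in>J. (norm (c n))\<^sup>2) / v) < v * (\<epsilon> / v)"
      using v by (rule mult_strict_left_mono)
    then have "v * L2_sqnorm ?M G - \<epsilon> \<le> (\<Sum>n\<in>J. (norm (c n))\<^sup>2)"
      using v by (simp add: right_diff_distrib)
    with J(1) show "\<exists>J. finite J \<and> v * L2_sqnorm ?M G - \<epsilon> \<le> (\<Sum>n\<in>J. (norm (c n))\<^sup>2)"
      by blast
  qed simp
  then show ?thesis
    by (simp add: c_def v_def)
qed

text \<open>Bounded support makes a square-integrable function integrable, so its transform is an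
  honest integral, and places it inside one cube, where Fourier series apply.\<close>

definition L2_bdd :: "(real^'n \<Rightarrow> complex) set" where
  "L2_bdd = {f \<in> L2 lborel. \<exists>R. \<forall>x. f x \<noteq> 0 \<longrightarrow> norm x \<le> R}"

text \<open>The sign of the exponent is that of the inverse transform: it takes functions of
  frequency to functions of position.\<close>

definition fourier :: "(real^'n \<Rightarrow> complex) \<Rightarrow> real^'n \<Rightarrow> complex" where
  "fourier f x = (\<integral>\<xi>. f \<xi> * wave x \<xi> \<partial>lborel)"

lemma L2_bddD: "f \<in> L2_bdd \<Longrightarrow> f \<in> L2 lborel"
  by (simp add: L2_bdd_def)

lemma L2_bdd_measurable: "f \<in> L2_bdd \<Longrightarrow> f \<in> borel_measurable borel"
  using L2_measurable[of f lborel] by (simp add: L2_bdd_def)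

lemma L2_bdd_integrable:
  assumes "f \<in> L2_bdd"
  shows "integrable lborel f"
proof -
  obtain R where R: "\<And>x. f x \<noteq> 0 \<Longrightarrow> norm x \<le> R"
    using assms by (auto simp: L2_bdd_def)
  have f: "f \<in> L2 lborel"
    using assms by (rule L2_bddD)
  show ?thesis
  proof (rule Bochner_Integration.integrable_bound)
    show "integrable lborel (\<lambda>x. indicator (cball 0 R) x + (norm (f x))\<^sup>2)"
      using L2_integrable[OF f] emeasure_lborel_cball_finite[of 0 R]
      by (intro Bochner_Integration.integrable_add integrable_real_indicator) auto
    show "f \<in> borel_measurable lborel"
      using f by (rule L2_measurable)
    have "norm (f x) \<le> 1 + (norm (f x))\<^sup>2" for x
      using sum_squares_bound[of 1 "norm (f x)"] norm_ge_zero[of "f x"]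
      unfolding one_power2 by linarith
    then have "norm (f x) \<le> indicator (cball 0 R) x + (norm (f x))\<^sup>2" for x
      using R[of x] by (cases "f x = 0") auto
    then show "AE x in lborel. norm (f x) \<le> norm (indicator (cball 0 R) x + (norm (f x))\<^sup>2)"
      by (intro AE_I2) (simp add: indicator_def)
  qed
qed

lemma L2_bdd_integrable_wave:
  assumes "f \<in> L2_bdd"
  shows "integrable lborel (\<lambda>\<xi>. f \<xi> * wave l \<xi>)"
  by (rule Bochner_Integration.integrable_bound[OF L2_bdd_integrable[OF assms]])
    (use L2_bdd_measurable[OF assms] in \<open>auto simp: norm_mult\<close>)

lemma L2_bdd_bound:
  assumes "f \<in> borel_measurable borel" "g \<in> L2_bdd" "\<And>x. norm (f x) \<le> C * norm (g x)"
  shows "f \<in> L2_bdd"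
proof -
  obtain R where R: "\<And>x. g x \<noteq> 0 \<Longrightarrow> norm x \<le> R"
    using assms(2) by (auto simp: L2_bdd_def)
  have "norm x \<le> R" if "f x \<noteq> 0" for x
    using assms(3)[of x] that by (intro R) auto
  moreover have "f \<in> L2 lborel"
    by (rule L2_bound[of _ _ g C]) (use assms in \<open>auto dest: L2_bddD\<close>)
  ultimately show ?thesis
    by (auto simp: L2_bdd_def)
qed

lemma csubspace_L2_bdd: "csubspace L2_bdd"
  unfolding csubspace_def
proof (intro conjI ballI allI)
  fix f g :: "real^'n \<Rightarrow> complex" assume f: "f \<in> L2_bdd" and g: "g \<in> L2_bdd"
  obtain R where R: "\<And>x. f x \<noteq> 0 \<Longrightarrow> norm x \<le> R"
    using f by (auto simp: L2_bdd_def)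
  obtain S where S: "\<And>x. g x \<noteq> 0 \<Longrightarrow> norm x \<le> S"
    using g by (auto simp: L2_bdd_def)
  have "norm x \<le> max R S" if "f x + g x \<noteq> 0" for x
  proof -
    have "f x \<noteq> 0 \<or> g x \<noteq> 0"
      using that by auto
    then show ?thesis
      using R[of x] S[of x] by auto
  qed
  then show "(\<lambda>x. f x + g x) \<in> L2_bdd"
    using f g by (auto simp: L2_bdd_def intro: L2_add)
next
  fix f :: "real^'n \<Rightarrow> complex" and c assume f: "f \<in> L2_bdd"
  then show "(\<lambda>x. c * f x) \<in> L2_bdd"
    using L2_bdd_measurable[OF f]
    by (intro L2_bdd_bound[of "\<lambda>x. c * f x" f "norm c"]) (auto simp: norm_mult)
qed (simp add: L2_bdd_def)

lemma fourier_measurable [measurable]: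
  assumes "f \<in> L2_bdd"
  shows "fourier f \<in> borel_measurable borel"
proof -
  have [measurable]: "f \<in> borel_measurable borel"
    using assms by (rule L2_bdd_measurable)
  show ?thesis
    unfolding fourier_def by measurable
qed

lemma fourier_add: "f \<in> L2_bdd \<Longrightarrow> g \<in> L2_bdd \<Longrightarrow> fourier (\<lambda>x. f x + g x) y = fourier f y + fourier g y"
  by (simp add: fourier_def distrib_right L2_bdd_integrable_wave)

lemma fourier_cmult: "fourier (\<lambda>x. c * f x) y = c * fourier f y"
  by (simp add: fourier_def mult.assoc)

lemma fourier_sum:
  "finite J \<Longrightarrow> (\<And>i. i \<in> J \<Longrightarrow> g i \<in> L2_bdd) \<Longrightarrow>
    fourier (\<lambda>x. \<Sum>i\<in>J. u i * g i x) y = (\<Sum>i\<in>J. u i * fourier (g i) y)"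
proof (induction J rule: finite_induct)
  case (insert i J)
  have "(\<lambda>x. u i * g i x) \<in> L2_bdd" "(\<lambda>x. \<Sum>i\<in>J. u i * g i x) \<in> L2_bdd"
    using insert.prems
    by (auto intro!: csubspace_sum[OF csubspace_L2_bdd] csubspace_cmult[OF csubspace_L2_bdd])
  then show ?case
    using insert by (simp add: fourier_add fourier_cmult)
qed (simp add: fourier_def)

lemma fourier_diff: "f \<in> L2_bdd \<Longrightarrow> g \<in> L2_bdd \<Longrightarrow> fourier (\<lambda>x. f x - g x) y = fourier f y - fourier g y"
  by (simp add: fourier_def left_diff_distrib L2_bdd_integrable_wave)

text \<open>
  The values of the transform of \<open>f\<close> on a translate by \<open>\<theta>\<close> of the dual lattice are the Fourier
  coefficients of \<open>f\<close> times an exponential, so Parseval's identity integrated over \<open>\<theta>\<close> gives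
  Plancherel's theorem.
\<close>

lemma nn_integral_fourier:
  fixes f :: "real^'n \<Rightarrow> complex"
  assumes f: "f \<in> L2_bdd"
  shows "(\<integral>\<^sup>+x. ennreal ((norm (fourier f x))\<^sup>2) \<partial>lborel) = ennreal (L2_sqnorm lborel f)"
proof -
  obtain R where R: "\<And>x. f x \<noteq> 0 \<Longrightarrow> norm x \<le> R"
    using f by (auto simp: L2_bdd_def)
  \<comment> \<open>The side exceeds \<open>2 * \<bar>R\<bar>\<close>, so the centred half-open cube
    \<open>A\<close> contains the support; the dual lattice has spacing
    \<open>1 / P\<close>.\<close>
  define P where "P = 2 * \<bar>R\<bar> + 1"
  define p :: "real^'n" where "p = (\<chi> i. P)"
  define q :: "real^'n" where "q = (\<chi> i. 1 / P)"
  define A where "A = {x. x + (\<chi> i. P / 2) \<in> half_open_box p}"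
  have P: "P > 0"
    by (simp add: P_def)
  have p: "\<forall>i. p $ i > 0" and q: "\<forall>i. q $ i > 0"
    using P by (simp_all add: p_def q_def)
  have A: "tile p A"
    unfolding A_def by (intro tile_shift tile_half_open_box p)
  have [measurable]: "A \<in> sets borel"
    using A by (rule tile_sets)
  note Q = tile_half_open_box[OF q]
  have fA: "x \<in> A" if "f x \<noteq> 0" for x
  proof -
    have "\<bar>x $ i\<bar> \<le> \<bar>R\<bar>" for i
      using component_le_norm_cart[of x i] R[OF that] by linarith
    then have "0 \<le> x $ i + P / 2" "x $ i + P / 2 < P" for i
      using abs_le_D1[of "x $ i" "\<bar>R\<bar>"] abs_le_D2[of "x $ i" "\<bar>R\<bar>"]
      by (auto simp: P_def field_simps intro: order_le_less_trans)
    then show ?thesis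
      by (simp add: A_def p_def half_open_box_def)
  qed
  have fb [measurable]: "f \<in> borel_measurable borel"
    using f by (rule L2_bdd_measurable)
  have restr: "(\<integral>x. g x \<partial>lborel_restr A) = (\<integral>x. g x \<partial>lborel)"
    if "g \<in> borel_measurable borel" "\<And>x. f x = 0 \<Longrightarrow> g x = 0"
    for g :: "real^'n \<Rightarrow> 'b :: {banach, second_countable_topology}"
  proof -
    have "(\<integral>x. g x \<partial>lborel_restr A) = (\<integral>x. indicator A x *\<^sub>R g x \<partial>lborel)"
      using that(1) by (subst integral_density[where g = "\<lambda>x. indicator A x", simplified ennreal_indicator]) auto
    also have "\<dots> = (\<integral>x. g x \<partial>lborel)"
      using fA that(2) by (intro Bochner_Integration.integral_cong) (auto simp: indicator_def)
    finally show ?thesis .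
  qed
  have G: "(\<lambda>\<xi>. f \<xi> * wave \<theta> \<xi>) \<in> L2 (lborel_restr A)" for \<theta>
  proof (rule L2I)
    have "integrable lborel (\<lambda>x. indicator A x *\<^sub>R (norm (f x))\<^sup>2)"
      using L2_integrable[OF L2_bddD[OF f]] by (intro integrable_mult_indicator) auto
    then show "integrable (lborel_restr A) (\<lambda>x. (norm (f x * wave \<theta> x))\<^sup>2)"
      by (subst integrable_density[where g = "\<lambda>x. indicator A x", simplified ennreal_indicator])
        (auto simp: norm_mult)
  qed simp
  have sq: "L2_sqnorm (lborel_restr A) (\<lambda>\<xi>. f \<xi> * wave \<theta> \<xi>) = L2_sqnorm lborel f" for \<theta>
    unfolding L2_sqnorm_def by (subst restr) (auto simp: norm_mult)
  have coeff: "fourier f (\<theta> + lattice_vec q (- n))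
      = (\<integral>\<xi>. f \<xi> * wave \<theta> \<xi> * cnj (wave (dual_vec p n) \<xi>) \<partial>lborel_restr A)" for \<theta> n
  proof -
    have "lattice_vec q (- n) = - dual_vec p n"
      by (simp add: lattice_vec_def dual_vec_def q_def p_def vec_eq_iff)
    then have "wave (\<theta> + lattice_vec q (- n)) \<xi> = wave \<theta> \<xi> * cnj (wave (dual_vec p n) \<xi>)" for \<xi>
      by (simp only: wave_add_left cnj_wave)
    then show ?thesis
      unfolding fourier_def by (subst restr) (auto simp: mult.assoc)
  qed
  have sum: "(\<integral>\<^sup>+n. ennreal ((norm (fourier f (\<theta> + lattice_vec q n)))\<^sup>2) \<partial>count_space UNIV)
      = ennreal (P ^ CARD('n) * L2_sqnorm lborel f)" for \<theta>
  proof -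
    have "(\<integral>\<^sup>+n. ennreal ((norm (fourier f (\<theta> + lattice_vec q n)))\<^sup>2) \<partial>count_space UNIV)
        = (\<integral>\<^sup>+n. ennreal ((norm (fourier f (\<theta> + lattice_vec q (- n))))\<^sup>2) \<partial>count_space UNIV)"
      by (rule nn_integral_bij_count_space[of uminus UNIV UNIV, symmetric]) (auto intro: bij_uminus)
    also have "\<dots> = ennreal ((\<Prod>i\<in>UNIV. p $ i) * L2_sqnorm lborel f)"
      unfolding coeff using Parseval_tile[OF p A G] by (simp add: sq)
    finally show ?thesis
      by (simp add: p_def)
  qed
  \<comment> \<open>Unfolding along the dual cube, whose volume cancels the volume factor in
    Parseval's identity.\<close>
  have "(\<integral>\<^sup>+x. ennreal ((norm (fourier f x))\<^sup>2) \<partial>lborel)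
      = (\<integral>\<^sup>+x. ennreal (P ^ CARD('n) * L2_sqnorm lborel f) * indicator (half_open_box q) x \<partial>lborel)"
    using f by (subst nn_integral_tile_sum[OF Q]) (simp_all add: sum)
  also have "\<dots> = ennreal (P ^ CARD('n) * L2_sqnorm lborel f) * ennreal ((1 / P) ^ CARD('n))"
    using tile_sets[OF Q] emeasure_half_open_box[OF q]
    by (subst nn_integral_cmult_indicator) (simp_all add: q_def)
  also have "\<dots> = ennreal (L2_sqnorm lborel f)"
    using P by (simp flip: ennreal_mult) (simp add: power_divide)
  finally show ?thesis .
qed

theorem Plancherel:
  assumes f: "f \<in> L2_bdd"
  shows "fourier f \<in> L2 lborel" "L2_sqnorm lborel (fourier f) = L2_sqnorm lborel f"
proof -
  have [measurable]: "fourier f \<in> borel_measurable borel"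
    using f by (rule fourier_measurable)
  show "fourier f \<in> L2 lborel"
    by (intro L2I integrableI_bounded) (simp_all add: nn_integral_fourier[OF f])
  show "L2_sqnorm lborel (fourier f) = L2_sqnorm lborel f"
    unfolding L2_sqnorm_def[of _ "fourier f"]
    by (subst integral_eq_nn_integral) (simp_all add: nn_integral_fourier[OF f])
qed

text \<open>The kernel is symmetric, so Fubini moves the transform across the pairing; what arises
  on the other side is its adjoint. Both functions are integrable and the kernel is bounded, which
  gives absolute integrability on the product.\<close>

lemma integral_fourier_pairing:
  assumes f: "f \<in> L2_bdd" and g: "g \<in> L2_bdd"
  shows "(\<integral>x. f x * cnj (fourier g x) \<partial>lborel)
     = (\<integral>x. cnj (fourier (\<lambda>\<xi>. cnj (f \<xi>)) x) * cnj (g x) \<partial>lborel)"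
proof -
  have [measurable]: "f \<in> borel_measurable borel" "g \<in> borel_measurable borel"
    using f g by (auto intro: L2_bdd_measurable)
  have sym: "wave x y = wave y x" for x y :: "real^'a"
    by (simp add: wave_def inner_commute)
  have "integrable (lborel \<Otimes>\<^sub>M lborel) (\<lambda>(x, y). f x * cnj (g y * wave x y))"
  proof (rule lborel_pair.Fubini_integrable)
    show "(\<lambda>(x, y). f x * cnj (g y * wave x y)) \<in> borel_measurable (lborel \<Otimes>\<^sub>M lborel)"
      by measurable
    show "integrable lborel (\<lambda>x. \<integral>y. norm (case (x, y) of (x, y) \<Rightarrow> f x * cnj (g y * wave x y)) \<partial>lborel)"
      using L2_bdd_integrable[OF f] by (simp add: norm_mult)
    show "AE x in lborel. integrable lborel (\<lambda>y. case (x, y) of (x, y) \<Rightarrow> f x * cnj (g y * wave x y))"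
      using L2_bdd_integrable_wave[OF g] by (auto intro!: AE_I2 integrable_mult_right simp del: complex_cnj_mult)
  qed
  note F = lborel_pair.Fubini_integral[OF this]
  have "(\<integral>x. f x * cnj (fourier g x) \<partial>lborel) = (\<integral>x. (\<integral>y. f x * cnj (g y * wave x y) \<partial>lborel) \<partial>lborel)"
    unfolding fourier_def
    by (simp only: Bochner_Integration.integral_cnj[symmetric] integral_mult_right_zero)
  also have "\<dots> = (\<integral>y. (\<integral>x. f x * cnj (g y * wave x y) \<partial>lborel) \<partial>lborel)"
    by (rule F[symmetric])
  also have "\<dots> = (\<integral>y. cnj (fourier (\<lambda>\<xi>. cnj (f \<xi>)) y) * cnj (g y) \<partial>lborel)"
  proof (rule Bochner_Integration.integral_cong[OF refl])
    fix y
    have "(\<integral>x. f x * cnj (g y * wave x y) \<partial>lborel) = (\<integral>x. cnj (cnj (f x) * wave y x) * cnj (g y) \<partial>lborel)"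
      by (simp add: mult_ac sym[of _ y])
    also have "\<dots> = cnj (fourier (\<lambda>\<xi>. cnj (f \<xi>)) y) * cnj (g y)"
      unfolding fourier_def by (subst Bochner_Integration.integral_cnj[symmetric]) (simp only: integral_mult_left_zero)
    finally show "(\<integral>x. f x * cnj (g y * wave x y) \<partial>lborel) = cnj (fourier (\<lambda>\<xi>. cnj (f \<xi>)) y) * cnj (g y)" .
  qed
  finally show ?thesis .
qed

section \<open>Density of the range of the transform\<close>

lemma L2_truncate:
  assumes "f \<in> L2 lborel"
  shows "(\<lambda>x. indicator (cball 0 R) x * f x) \<in> L2_bdd"
proof -
  have "f \<in> borel_measurable borel"
    using L2_measurable[OF assms] by simp
  then have "(\<lambda>x. indicator (cball 0 R) x * f x) \<in> L2 lborel"
    by (intro L2_bound[OF _ assms, where C = 1]) (auto simp: norm_mult indicator_def)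
  then show ?thesis
    by (auto simp: L2_bdd_def indicator_def)
qed

lemma truncate_tendsto:
  "(\<lambda>n. indicator (cball 0 (real n)) x * (f x :: complex)) \<longlonglongrightarrow> f (x :: 'a :: real_normed_vector)"
proof (rule tendsto_eventually)
  show "\<forall>\<^sub>F n in sequentially. indicator (cball 0 (real n)) x * f x = f x"
    using eventually_ge_at_top[of "nat \<lceil>norm x\<rceil>"] by eventually_elim (simp add: indicator_def)
qed

text \<open>
  The adjoint of the isometry \<open>fourier\<close> is again an isometry, namely \<open>fourier\<close> conjugated by complex
  conjugation. Hence \<open>fourier\<close> has dense range.
\<close>

theorem fourier_dense: "L2 lborel \<subseteq> L2_closure lborel (fourier ` (L2_bdd :: (real^'n \<Rightarrow> complex) set))"
proof
  let ?V = "fourier ` (L2_bdd :: (real^'n \<Rightarrow> complex) set)"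
  have V: "?V \<subseteq> L2 lborel"
    using Plancherel by auto
  fix f :: "real^'n \<Rightarrow> complex" assume f: "f \<in> L2 lborel"
  have bdd: "f \<in> L2_closure lborel ?V" if f: "f \<in> L2_bdd" for f :: "real^'n \<Rightarrow> complex"
  proof (rule L2_closureI[OF L2_bddD[OF f]])
    fix e :: real assume "e > 0"
    have cf: "(\<lambda>x. cnj (f x)) \<in> L2_bdd"
      using f by (auto simp: L2_bdd_def intro: L2_cnj)
    \<comment> \<open>The adjoint applied to \<open>f\<close>. Its support need not be bounded,
      hence the truncations \<open>g n\<close>.\<close>
    define h where "h x = cnj (fourier (\<lambda>\<xi>. cnj (f \<xi>)) x)" for x
    have h: "h \<in> L2 lborel"
      unfolding h_def by (intro L2_cnj Plancherel cf)
    have "L2_sqnorm lborel h = L2_sqnorm lborel (fourier (\<lambda>\<xi>. cnj (f \<xi>)))"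
      by (simp add: h_def L2_sqnorm_def)
    also have "\<dots> = L2_sqnorm lborel f"
      by (subst Plancherel[OF cf]) (simp add: L2_sqnorm_def)
    finally have hf: "L2_sqnorm lborel h = L2_sqnorm lborel f" .
    define g where "g n x = indicator (cball 0 (real n)) x * h x" for n x
    have g: "g n \<in> L2_bdd" for n
      unfolding g_def by (rule L2_truncate[OF h])
    have norm_g: "norm (g n x) \<le> norm (h x)" for n x
      by (simp add: g_def indicator_def)
    have "(\<lambda>n. L2_sqnorm lborel (g n)) \<longlonglongrightarrow> L2_sqnorm lborel h"
      unfolding L2_sqnorm_def
    proof (rule integral_dominated_convergence)
      show "integrable lborel (\<lambda>x. (norm (h x))\<^sup>2)"
        using h by (rule L2_integrable)
      show "AE x in lborel. (\<lambda>n. (norm (g n x))\<^sup>2) \<longlonglongrightarrow> (norm (h x))\<^sup>2"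
        unfolding g_def by (intro AE_I2 tendsto_power tendsto_norm truncate_tendsto)
      show "AE x in lborel. norm ((norm (g n x))\<^sup>2) \<le> (norm (h x))\<^sup>2" for n
        using norm_g by (auto intro!: AE_I2 power_mono)
    qed (use L2_measurable[OF h] L2_bdd_measurable[OF g] in auto)
    then have "eventually (\<lambda>n. L2_sqnorm lborel h - e < L2_sqnorm lborel (g n)) sequentially"
      using \<open>e > 0\<close> by (intro order_tendstoD) auto
    then obtain n where n: "L2_sqnorm lborel h - e < L2_sqnorm lborel (g n)"
      by (auto simp: eventually_sequentially)
    \<comment> \<open>Since \<open>g n\<close> is a restriction of \<open>h\<close>, its squared
      norm is its pairing with \<open>h\<close>, hence that of \<open>fourier (g n)\<close> with
      \<open>f\<close>. The squared distance between the latter two is therefore the difference of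
      the squared norms of \<open>h\<close> and \<open>g n\<close>.\<close>
    have "complex_of_real (L2_sqnorm lborel (g n)) = (\<integral>x. h x * cnj (g n x) \<partial>lborel)"
      unfolding L2_sqnorm_def by (subst integral_complex_of_real[symmetric], rule Bochner_Integration.integral_cong)
        (auto simp: g_def indicator_def complex_norm_square simp flip: of_real_power)
    also have "\<dots> = (\<integral>x. f x * cnj (fourier (g n) x) \<partial>lborel)"
      unfolding h_def by (rule integral_fourier_pairing[OF f g, symmetric])
    finally have "Re (\<integral>x. f x * cnj (fourier (g n) x) \<partial>lborel) = L2_sqnorm lborel (g n)"
      by (metis Re_complex_of_real)
    then have "L2_sqnorm lborel (\<lambda>x. f x - fourier (g n) x) = L2_sqnorm lborel f - L2_sqnorm lborel (g n)"
      by (simp add: L2_sqnorm_diff[OF L2_bddD[OF f] Plancherel(1)[OF g]] Plancherel(2)[OF g])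
    then show "\<exists>g\<in>?V. L2_sqnorm lborel (\<lambda>x. f x - g x) < e"
      using n g hf by (intro bexI[of _ "fourier (g n)"]) auto
  qed
  show "f \<in> L2_closure lborel ?V"
  proof (rule L2_closure_dominated[OF V, where g = "\<lambda>n x. indicator (cball 0 (real n)) x * f x"])
    show "(\<lambda>x. indicator (cball 0 (real n)) x * f x) \<in> L2_closure lborel ?V" for n
      by (intro bdd L2_truncate f)
    show "AE x in lborel. (\<lambda>n. indicator (cball 0 (real n)) x * f x) \<longlonglongrightarrow> f x"
      by (intro AE_I2 truncate_tendsto)
    show "norm (indicator (cball 0 (real n)) x * f x) \<le> norm (f x)" for n x
      by (simp add: indicator_def)
  qed (use L2_measurable[OF f] L2_integrable[OF f] in auto)
qed

subsection \<open>Dilations\<close>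

lemma matrix_inv_cancel:
  fixes A :: "real^'n^'n"
  assumes "det A \<noteq> 0"
  shows "A ** matrix_inv A = mat 1" "matrix_inv A ** A = mat 1"
proof -
  have "\<exists>B. A ** B = mat 1 \<and> B ** A = mat 1"
    using assms by (simp add: invertible_det_nz[symmetric] invertible_def)
  then have "A ** matrix_inv A = mat 1 \<and> matrix_inv A ** A = mat 1"
    unfolding matrix_inv_def by (rule someI_ex)
  then show "A ** matrix_inv A = mat 1" "matrix_inv A ** A = mat 1"
    by auto
qed

lemma matrix_inv_vector_cancel:
  fixes A :: "real^'n^'n"
  assumes "det A \<noteq> 0"
  shows "A *v (matrix_inv A *v x) = x" "matrix_inv A *v (A *v x) = x"
  using matrix_inv_cancel[OF assms] by (simp_all add: matrix_vector_mul_assoc)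

lemma matrix_inv_mult:
  fixes A B :: "real^'n^'n"
  assumes "det A \<noteq> 0" "det B \<noteq> 0"
  shows "matrix_inv (A ** B) = matrix_inv B ** matrix_inv A"
proof -
  have d: "det (A ** B) \<noteq> 0"
    using assms by (simp add: det_mul)
  have "matrix_inv (A ** B) ** (A ** B) ** (matrix_inv B ** matrix_inv A)
      = matrix_inv (A ** B) ** (A ** (B ** matrix_inv B) ** matrix_inv A)"
    by (simp add: matrix_mul_assoc)
  then show ?thesis
    by (simp add: matrix_inv_cancel[OF d] matrix_inv_cancel[OF assms(1)] matrix_inv_cancel[OF assms(2)])
qed

lemma borel_measurable_matrix_vector [measurable]:
  "(\<lambda>x. (A :: real^'n^'m) *v x) \<in> borel_measurable borel"
  by (intro borel_measurable_continuous_onI linear_continuous_on matrix_vector_mul_bounded_linear)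

text \<open>Lebesgue measure is determined by its values on boxes, and the preimage of a box is its
  image under the inverse matrix, whose volume is known.\<close>

lemma lborel_matrix:
  fixes A :: "real^'n::{finite,wellorder}^'n::_"
  assumes A: "det A \<noteq> 0"
  shows "lborel = density (distr lborel borel ((*v) A)) (\<lambda>_. ennreal \<bar>det A\<bar>)"
proof (rule lborel_eqI)
  let ?B = "matrix_inv A"
  fix l u :: "real^'n::_" assume lu: "\<And>b. b \<in> Basis \<Longrightarrow> l \<bullet> b \<le> u \<bullet> b"
  have dAB: "det A * det ?B = 1"
    using matrix_inv_cancel(1)[OF A] by (metis det_I det_mul)
  have vim: "(*v) A -` box l u = (*v) ?B ` box l u"
    using matrix_inv_vector_cancel[OF A] by (auto simp: image_iff) metis
  have s: "(*v) A -` box l u \<in> sets borel"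
    using measurable_sets[OF borel_measurable_matrix_vector[of A], of "box l u"] by (simp add: borel_open)
  have lm: "box l u \<in> lmeasurable"
    by simp
  have m: "(*v) ?B ` box l u \<in> lmeasurable"
    "measure lebesgue ((*v) ?B ` box l u) = \<bar>det ?B\<bar> * measure lebesgue (box l u)"
    using measurable_linear_image[OF _ lm, of "(*v) ?B"] measure_linear_image[OF _ lm, of "(*v) ?B"]
    by simp_all
  have "emeasure lborel ((*v) A -` box l u) = emeasure lebesgue ((*v) ?B ` box l u)"
    using s unfolding vim by (simp add: emeasure_completion)
  also have "\<dots> = ennreal (\<bar>det ?B\<bar> * measure lebesgue (box l u))"
    using m by (simp add: emeasure_eq_measure2)
  finally have e: "emeasure lborel ((*v) A -` box l u) = ennreal (\<bar>det ?B\<bar> * measure lebesgue (box l u))" .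
  have "emeasure (density (distr lborel borel ((*v) A)) (\<lambda>_. ennreal \<bar>det A\<bar>)) (box l u)
      = ennreal \<bar>det A\<bar> * emeasure lborel ((*v) A -` box l u)"
    by (subst emeasure_density_const) (simp_all add: emeasure_distr borel_open)
  also have "\<dots> = ennreal (\<bar>det A * det ?B\<bar> * measure lebesgue (box l u))"
    unfolding e by (simp add: ennreal_mult[symmetric] abs_mult)
  also have "\<dots> = (\<Prod>b\<in>Basis. (u - l) \<bullet> b)"
    unfolding dAB using lu by simp
  finally show "emeasure (density (distr lborel borel ((*v) A)) (\<lambda>_. ennreal \<bar>det A\<bar>)) (box l u)
      = ennreal (\<Prod>b\<in>Basis. (u - l) \<bullet> b)" .
qed simp

lemma integral_matrix_change:
  fixes A :: "real^'n::{finite,wellorder}^'n::_" and f :: "real^'n::_ \<Rightarrow> 'b :: {banach, second_countable_topology}"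
  assumes A: "det A \<noteq> 0" and [measurable]: "f \<in> borel_measurable borel"
  shows "(\<integral>x. \<bar>det A\<bar> *\<^sub>R f (A *v x) \<partial>lborel) = (\<integral>x. f x \<partial>lborel)"
    and "integrable lborel (\<lambda>x. \<bar>det A\<bar> *\<^sub>R f (A *v x)) \<longleftrightarrow> integrable lborel f"
proof -
  show "(\<integral>x. \<bar>det A\<bar> *\<^sub>R f (A *v x) \<partial>lborel) = (\<integral>x. f x \<partial>lborel)"
    by (subst (2) lborel_matrix[OF A]) (simp add: integral_density integral_distr)
  show "integrable lborel (\<lambda>x. \<bar>det A\<bar> *\<^sub>R f (A *v x)) \<longleftrightarrow> integrable lborel f"
    by (subst (2) lborel_matrix[OF A]) (simp add: integrable_density integrable_distr_eq)
qed

definition freq_dilation :: "real^'n^'n \<Rightarrow> (real^'n \<Rightarrow> complex) \<Rightarrow> real^'n \<Rightarrow> complex" where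
  "freq_dilation A g x = complex_of_real (sqrt \<bar>det A\<bar>) * g (transpose A *v x)"

lemma freq_dilation_measurable [measurable]:
  assumes [measurable]: "g \<in> borel_measurable borel"
  shows "freq_dilation A g \<in> borel_measurable borel"
  unfolding freq_dilation_def by (simp del: transpose_matrix_vector)

lemma integral_freq_dilation:
  fixes A :: "real^'n::{finite,wellorder}^'n::_"
  assumes A: "det A \<noteq> 0" and [measurable]: "f \<in> borel_measurable borel" "g \<in> borel_measurable borel"
  shows "(\<integral>x. freq_dilation A f x * cnj (freq_dilation A g x) \<partial>lborel) = (\<integral>x. f x * cnj (g x) \<partial>lborel)"
proof -
  have "complex_of_real (sqrt \<bar>det A\<bar>) * complex_of_real (sqrt \<bar>det A\<bar>) = of_real \<bar>det A\<bar>"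
    by (simp flip: of_real_mult)
  then have "freq_dilation A f x * cnj (freq_dilation A g x)
      = \<bar>det (transpose A)\<bar> *\<^sub>R (f (transpose A *v x) * cnj (g (transpose A *v x)))" for x
    by (simp add: freq_dilation_def scaleR_conv_of_real mult_ac del: transpose_matrix_vector)
  then show ?thesis
    using integral_matrix_change(1)[of "transpose A" "\<lambda>x. f x * cnj (g x)"] A by simp
qed

lemma L2_freq_dilation:
  fixes A :: "real^'n::{finite,wellorder}^'n::_"
  assumes A: "det A \<noteq> 0" and [measurable]: "g \<in> borel_measurable borel"
  shows "freq_dilation A g \<in> L2 lborel \<longleftrightarrow> g \<in> L2 lborel"
    and "L2_sqnorm lborel (freq_dilation A g) = L2_sqnorm lborel g"
proof -
  have *: "(norm (freq_dilation A g x))\<^sup>2 = \<bar>det (transpose A)\<bar> *\<^sub>R (norm (g (transpose A *v x)))\<^sup>2" for x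
    by (simp add: freq_dilation_def norm_mult power_mult_distrib del: transpose_matrix_vector)
  show "freq_dilation A g \<in> L2 lborel \<longleftrightarrow> g \<in> L2 lborel"
    unfolding L2_def mem_Collect_eq * using integral_matrix_change(2)[of "transpose A" "\<lambda>x. (norm (g x))\<^sup>2"] A
    by (simp del: transpose_matrix_vector real_scaleR_def)
  show "L2_sqnorm lborel (freq_dilation A g) = L2_sqnorm lborel g"
    unfolding L2_sqnorm_def * using integral_matrix_change(1)[of "transpose A" "\<lambda>x. (norm (g x))\<^sup>2"] A
    by (simp del: transpose_matrix_vector real_scaleR_def)
qed

lemma L2_bdd_freq_dilation:
  fixes A :: "real^'n::{finite,wellorder}^'n::_"
  assumes A: "det A \<noteq> 0" and g: "g \<in> L2_bdd"
  shows "freq_dilation A g \<in> L2_bdd"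
proof -
  have [measurable]: "g \<in> borel_measurable borel"
    using g by (rule L2_bdd_measurable)
  obtain R where R: "\<And>x. g x \<noteq> 0 \<Longrightarrow> norm x \<le> R"
    using g by (auto simp: L2_bdd_def)
  have A': "det (transpose A) \<noteq> 0"
    using A by simp
  obtain K where K: "\<And>x. norm (matrix_inv (transpose A) *v x) \<le> K * norm x" "K > 0"
    using linear_bounded_pos[OF matrix_vector_mul_linear[of "matrix_inv (transpose A)"]] by auto
  have "norm x \<le> K * R" if "freq_dilation A g x \<noteq> 0" for x
  proof -
    have "norm x \<le> K * norm (transpose A *v x)"
      using K(1)[of "transpose A *v x"] by (simp only: matrix_inv_vector_cancel[OF A'])
    also have "norm (transpose A *v x) \<le> R"
      using that by (intro R) (auto simp: freq_dilation_def)
    finally show ?thesis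
      using K(2) by simp
  qed
  then show ?thesis
    using g L2_freq_dilation(1)[OF A, of g] by (auto simp: L2_bdd_def)
qed

text \<open>Substitution by \<open>transpose A\<close>, which undoes \<open>matrix_inv A\<close>
  inside the inner product. The Jacobian \<open>\<bar>det A\<bar>\<close> and the normalising power
  \<open>- 1 / 2\<close> combine to the square root in \<open>freq_dilation\<close>.\<close>

lemma dilation_op_fourier:
  fixes A :: "real^2^2"
  assumes A: "det A \<noteq> 0" and [measurable]: "g \<in> borel_measurable borel"
  shows "dilation_op A (fourier g) = fourier (freq_dilation A g)"
proof
  fix x
  have sqrt: "\<bar>det A\<bar> powr (- 1 / 2) * \<bar>det A\<bar> = sqrt \<bar>det A\<bar>"
  proof -
    have "\<bar>det A\<bar> powr (- 1 / 2) * \<bar>det A\<bar> powr 1 = \<bar>det A\<bar> powr (1 / 2)"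
      by (subst powr_add[symmetric]) simp
    then show ?thesis
      using A by (simp add: powr_half_sqrt)
  qed
  have inner: "(matrix_inv A *v x) \<bullet> (transpose A *v y) = x \<bullet> y" for y
    by (simp add: inner_commute[of _ "y v* A"] dot_lmul_matrix matrix_inv_vector_cancel[OF A])
      (rule inner_commute)
  have "fourier g (matrix_inv A *v x)
      = (\<integral>y. \<bar>det (transpose A)\<bar> *\<^sub>R (g (transpose A *v y) * wave (matrix_inv A *v x) (transpose A *v y)) \<partial>lborel)"
    unfolding fourier_def using A by (subst integral_matrix_change(1)) simp_all
  also have "\<dots> = (\<integral>y. \<bar>det A\<bar> *\<^sub>R (g (transpose A *v y) * wave x y) \<partial>lborel)"
    unfolding wave_def inner by simp
  finally have "dilation_op A (fourier g) x
      = complex_of_real (\<bar>det A\<bar> powr (- 1 / 2) * \<bar>det A\<bar>) * (\<integral>y. g (transpose A *v y) * wave x y \<partial>lborel)"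
    by (simp add: dilation_op_def scaleR_conv_of_real mult.assoc del: transpose_matrix_vector)
  also have "\<dots> = (\<integral>y. complex_of_real (sqrt \<bar>det A\<bar>) * (g (transpose A *v y) * wave x y) \<partial>lborel)"
    unfolding sqrt by (rule integral_mult_right_zero[symmetric])
  finally show "dilation_op A (fourier g) x = fourier (freq_dilation A g) x"
    by (simp add: fourier_def freq_dilation_def mult.assoc)
qed

lemma translation_op_fourier: "translation_op l (fourier g) = fourier (\<lambda>\<xi>. wave (- l) \<xi> * g \<xi>)"
proof
  fix x
  have "wave (x - l) \<xi> = wave x \<xi> * wave (- l) \<xi>" for \<xi>
    using wave_add_left[of x "- l" \<xi>] by simp
  then show "translation_op l (fourier g) x = fourier (\<lambda>\<xi>. wave (- l) \<xi> * g \<xi>) x"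
    by (simp add: translation_op_def fourier_def mult_ac)
qed

lemma dilation_op_mult:
  fixes A B :: "real^2^2"
  assumes "det A \<noteq> 0" "det B \<noteq> 0"
  shows "dilation_op A (dilation_op B f) = dilation_op (A ** B) f"
  using assms
  by (simp add: dilation_op_def fun_eq_iff det_mul abs_mult powr_mult matrix_inv_mult
      matrix_vector_mul_assoc mult.assoc)

section \<open>Borel representatives and transfer of bases to Lebesgue measure\<close>

lemma completion_ex_borel_measurable_complex:
  assumes f: "f \<in> borel_measurable (completion M)"
  obtains g :: "'a \<Rightarrow> complex" where "g \<in> borel_measurable M" "AE x in completion M. f x = g x"
proof -
  have "(\<lambda>x. Re (f x)) \<in> borel_measurable (completion M)" "(\<lambda>x. Im (f x)) \<in> borel_measurable (completion M)"
    using f by auto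
  then obtain u v where u: "u \<in> borel_measurable M" "AE x in M. Re (f x) = u x"
    and v: "v \<in> borel_measurable M" "AE x in M. Im (f x) = v x"
    using completion_ex_borel_measurable_real by metis
  have "AE x in M. f x = Complex (u x) (v x)"
    using u(2) v(2) by eventually_elim (simp add: complex_eq_iff)
  moreover have "(\<lambda>x. Complex (u x) (v x)) \<in> borel_measurable M"
    using u(1) v(1) by (simp add: borel_measurable_complex_iff)
  ultimately show ?thesis
    using that AE_completion by blast
qed

lemma L2_completion: "f \<in> borel_measurable M \<Longrightarrow> f \<in> L2 (completion M) \<longleftrightarrow> f \<in> L2 M"
  and L2_sqnorm_completion: "f \<in> borel_measurable M \<Longrightarrow> L2_sqnorm (completion M) f = L2_sqnorm M f"
  by (auto simp: L2_def L2_sqnorm_def measurable_completion integrable_completion integral_completion)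

text \<open>An isometry with dense range carries a complete orthonormal family to another one, so
  both Riesz constants are 1.\<close>

theorem riesz_basis_fourier:
  fixes g :: "'i \<Rightarrow> real^'n \<Rightarrow> complex"
  assumes bdd: "\<And>i. i \<in> I \<Longrightarrow> g i \<in> L2_bdd"
    and ortho: "\<And>i j. i \<in> I \<Longrightarrow> j \<in> I \<Longrightarrow>
      (\<integral>x. g i x * cnj (g j x) \<partial>lborel) = (if i = j then 1 else 0)"
    and dense: "L2 lborel \<subseteq> L2_closure lborel (lin_comb I g)"
  shows "riesz_basis_L2 lebesgue I (\<lambda>i. fourier (g i))"
  unfolding riesz_basis_L2_def
proof (intro conjI ballI allI impI exI[of _ 1])
  fix i assume "i \<in> I"
  then show "fourier (g i) \<in> L2 lebesgue"
    using Plancherel(1)[OF bdd] L2_measurable L2_completion by blast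
next
  fix f :: "real^'n \<Rightarrow> complex" and \<epsilon> :: real
  assume f: "f \<in> L2 lebesgue" and "\<epsilon> > 0"
  \<comment> \<open>A Borel representative, since the density statements concern
    \<open>lborel\<close>.\<close>
  obtain f' where f' [measurable]: "f' \<in> borel_measurable lborel" and AE: "AE x in lebesgue. f x = f' x"
    using completion_ex_borel_measurable_complex[OF L2_measurable[OF f]] by auto
  have fm [measurable]: "f \<in> borel_measurable lebesgue" and f'm [measurable]: "f' \<in> borel_measurable lebesgue"
    using L2_measurable[OF f] f' by (auto intro: measurable_completion)
  have "integrable lebesgue (\<lambda>x. (norm (f' x))\<^sup>2)"
    using AE by (intro integrable_cong_AE_imp[OF L2_integrable[OF f]]) auto
  then have "f' \<in> L2 lborel"
    using L2_completion[OF f'] f'm by (auto intro: L2I)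
  then have "f' \<in> L2_closure lborel (fourier ` L2_bdd)"
    using fourier_dense by blast
  \<comment> \<open>Two squared errors below \<open>\<epsilon>\<^sup>2 / 4\<close>, each doubled by
    the triangle estimate, add up to less than \<open>\<epsilon>\<^sup>2\<close>.\<close>
  then obtain h where h: "h \<in> L2_bdd" "L2_sqnorm lborel (\<lambda>x. f' x - fourier h x) < \<epsilon>\<^sup>2 / 4"
    using \<open>\<epsilon> > 0\<close> by (elim L2_closureE[where e = "\<epsilon>\<^sup>2 / 4"]) auto
  have "h \<in> L2_closure lborel (lin_comb I g)"
    using dense h(1) by (auto dest: L2_bddD)
  then obtain g' where g': "g' \<in> lin_comb I g" "L2_sqnorm lborel (\<lambda>x. h x - g' x) < \<epsilon>\<^sup>2 / 4"
    using \<open>\<epsilon> > 0\<close> by (elim L2_closureE[where e = "\<epsilon>\<^sup>2 / 4"]) auto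
  then obtain J u where J: "finite J" "J \<subseteq> I" "g' = (\<lambda>x. \<Sum>i\<in>J. u i * g i x)"
    by (elim lin_combE) blast
  have "lin_comb I g \<subseteq> L2_bdd"
    using bdd by (intro lin_comb_subset csubspace_L2_bdd)
  with g'(1) have g'b: "g' \<in> L2_bdd"
    by (rule subsetD[rotated])
  have F: "fourier g' = (\<lambda>x. \<Sum>i\<in>J. u i * fourier (g i) x)"
    unfolding J(3) using J(1,2) bdd by (auto intro!: fourier_sum)
  have "L2_sqnorm lborel (\<lambda>x. fourier h x - fourier g' x) = L2_sqnorm lborel (\<lambda>x. h x - g' x)"
    using Plancherel(2)[OF csubspace_diff[OF csubspace_L2_bdd h(1) g'b]]
    by (simp add: L2_sqnorm_def fourier_diff[OF h(1) g'b])
  moreover have "L2_sqnorm lborel (\<lambda>x. f' x - fourier g' x)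
      \<le> 2 * L2_sqnorm lborel (\<lambda>x. f' x - fourier h x) + 2 * L2_sqnorm lborel (\<lambda>x. fourier h x - fourier g' x)"
    by (intro L2_sqnorm_triangle \<open>f' \<in> L2 lborel\<close> Plancherel h g'b)
  ultimately have small: "L2_sqnorm lborel (\<lambda>x. f' x - fourier g' x) < \<epsilon>\<^sup>2"
    using h(2) g'(2) by linarith
  have [measurable]: "fourier g' \<in> borel_measurable lborel" "fourier g' \<in> borel_measurable lebesgue"
    using fourier_measurable[OF g'b] by (auto intro: measurable_completion)
  have "L2_sqnorm lebesgue (\<lambda>x. f x - fourier g' x) = L2_sqnorm lebesgue (\<lambda>x. f' x - fourier g' x)"
    using AE by (intro L2_sqnorm_cong_AE) auto
  also have "\<dots> = L2_sqnorm lborel (\<lambda>x. f' x - fourier g' x)"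
    by (rule L2_sqnorm_completion) measurable
  finally have "L2_sqnorm lebesgue (\<lambda>x. f x - fourier g' x) < \<epsilon>\<^sup>2"
    using small by simp
  then have "L2_norm lebesgue (\<lambda>x. f x - fourier g' x) < \<epsilon>"
    using \<open>\<epsilon> > 0\<close> unfolding L2_norm_eq by (intro real_less_lsqrt) auto
  then show "\<exists>J u. finite J \<and> J \<subseteq> I \<and> L2_norm lebesgue (\<lambda>x. f x - (\<Sum>i\<in>J. u i * fourier (g i) x)) < \<epsilon>"
    using J(1,2) unfolding F by blast
next
  fix J and u :: "'i \<Rightarrow> complex" assume J: "finite J \<and> J \<subseteq> I"
  let ?g = "\<lambda>x. \<Sum>i\<in>J. u i * g i x"
  have gb: "?g \<in> L2_bdd"
    using J bdd by (intro csubspace_sum[OF csubspace_L2_bdd] csubspace_cmult[OF csubspace_L2_bdd]) auto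
  have F: "fourier ?g = (\<lambda>x. \<Sum>i\<in>J. u i * fourier (g i) x)"
    using J bdd by (auto intro!: fourier_sum)
  \<comment> \<open>The expansion formula for the zero function: its coefficients vanish and only
    the \<open>u i\<close> remain.\<close>
  have "L2_sqnorm lborel (\<lambda>x. 0 - ?g x) = (\<Sum>i\<in>J. (norm (u i))\<^sup>2)"
    by (subst L2_sqnorm_orthonormal) (use J bdd ortho in \<open>auto simp: L2_bddD subset_iff\<close>, simp add: L2_sqnorm_def)
  then have "L2_sqnorm lborel (fourier ?g) = (\<Sum>i\<in>J. (norm (u i))\<^sup>2)"
    using Plancherel(2)[OF gb] by (simp add: L2_sqnorm_def)
  then have "(L2_norm lebesgue (fourier ?g))\<^sup>2 = (\<Sum>i\<in>J. (norm (u i))\<^sup>2)"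
    using fourier_measurable[OF gb] by (simp add: L2_norm_power2 L2_sqnorm_completion)
  then show "1 * (\<Sum>i\<in>J. (norm (u i))\<^sup>2) \<le> (L2_norm lebesgue (\<lambda>x. \<Sum>i\<in>J. u i * fourier (g i) x))\<^sup>2"
    "(L2_norm lebesgue (\<lambda>x. \<Sum>i\<in>J. u i * fourier (g i) x))\<^sup>2 \<le> 1 * (\<Sum>i\<in>J. (norm (u i))\<^sup>2)"
    by (simp_all add: F)
qed simp_all

subsection \<open>Orthonormal bases from simultaneous tilings\<close>

lemma L2_lborel_restr:
  assumes [measurable]: "A \<in> sets borel" "g \<in> borel_measurable borel"
  shows "g \<in> L2 (lborel_restr A) \<longleftrightarrow> (\<lambda>x. indicator A x * g x) \<in> L2 lborel"
    and "L2_sqnorm (lborel_restr A) g = L2_sqnorm lborel (\<lambda>x. indicator A x * g x)"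
proof -
  have *: "(norm (indicator A x * g x))\<^sup>2 = indicator A x *\<^sub>R (norm (g x))\<^sup>2" for x
    by (simp add: indicator_def)
  show "g \<in> L2 (lborel_restr A) \<longleftrightarrow> (\<lambda>x. indicator A x * g x) \<in> L2 lborel"
    unfolding L2_def mem_Collect_eq *
    by (subst integrable_density[where g = "\<lambda>x. indicator A x", simplified ennreal_indicator]) auto
  show "L2_sqnorm (lborel_restr A) g = L2_sqnorm lborel (\<lambda>x. indicator A x * g x)"
    unfolding L2_sqnorm_def *
    by (subst integral_density[where g = "\<lambda>x. indicator A x", simplified ennreal_indicator]) auto
qed

lemma dual_vec_eq_iff: "\<forall>i. p $ i \<noteq> 0 \<Longrightarrow> dual_vec p m = dual_vec p n \<longleftrightarrow> m = n"
  by (simp add: dual_vec_def vec_eq_iff)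

text \<open>The factor gives unit norm when \<open>A\<close> is a tile for positive
  \<open>p\<close>.\<close>

definition tile_window :: "real^'n \<Rightarrow> (real^'n) set \<Rightarrow> real^'n \<Rightarrow> complex" where
  "tile_window p A x = complex_of_real (1 / sqrt (\<Prod>i\<in>UNIV. p $ i)) * indicator A x"

text \<open>Translation by \<open>l\<close> becomes multiplication by \<open>wave (- l)\<close>,
  whence the sign.\<close>

definition tile_atom :: "real^'n \<Rightarrow> (real^'n) set \<Rightarrow> real^'n \<Rightarrow> real^'n \<Rightarrow> complex" where
  "tile_atom p A l x = wave (- l) x * tile_window p A x"

text \<open>One set with two tilings: an additive one by the lattice with periods \<open>p\<close>,
  and a multiplicative one by the transposed matrices. The latter covers almost every point only, as
  no dilate of the set constructed below meets the axis where the first coordinate vanishes.\<close>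

locale dilation_tiling =
  fixes p :: "real^'n::{finite,wellorder}" and A :: "(real^'n::_) set"
    and B :: "'k :: countable \<Rightarrow> real^'n::_^'n::_"
  assumes p: "\<forall>i. p $ i > 0" and A: "tile p A" "bounded A"
    and B: "\<And>k. det (B k) \<noteq> 0"
    and disj: "\<And>k k' x. transpose (B k) *v x \<in> A \<Longrightarrow> transpose (B k') *v x \<in> A \<Longrightarrow> k = k'"
    and cover: "AE x in lborel. \<exists>k. transpose (B k) *v x \<in> A"
begin

lemma A_borel [measurable]: "A \<in> sets borel"
  using A(1) by (rule tile_sets)

lemma p_nonzero: "\<forall>i. p $ i \<noteq> 0"
  using p by (metis less_irrefl)

lemma tile_window_bdd: "tile_window p A \<in> L2_bdd"
proof -
  obtain R where R: "\<And>x. x \<in> A \<Longrightarrow> norm x \<le> R"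
    using A(2) by (auto simp: bounded_iff)
  have "tile_window p A \<in> L2 lborel"
    unfolding tile_window_def
    by (intro L2_cmult L2_indicator) (simp_all add: emeasure_tile[OF p A(1)])
  then show ?thesis
    using R by (auto simp: L2_bdd_def tile_window_def indicator_def)
qed

lemma tile_atom_bdd: "tile_atom p A l \<in> L2_bdd"
  using L2_bdd_measurable[OF tile_window_bdd]
  by (intro L2_bdd_bound[OF _ tile_window_bdd, where C = 1]) (auto simp: tile_atom_def[abs_def] norm_mult)

lemma tile_atom_measurable [measurable]: "tile_atom p A l \<in> borel_measurable borel"
  by (rule L2_bdd_measurable[OF tile_atom_bdd])

definition atom :: "'k \<times> (real^'n::_) \<Rightarrow> (real^'n::_) \<Rightarrow> complex" where
  "atom = (\<lambda>(k, l). freq_dilation (B k) (tile_atom p A l))"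

lemma atom_bdd: "atom i \<in> L2_bdd"
  by (cases i) (simp add: atom_def L2_bdd_freq_dilation B tile_atom_bdd)

text \<open>Different \<open>k\<close> give disjoint supports; equal \<open>k\<close> reduce, by
  unitarity of the dilation, to exponentials on the tile.\<close>

lemma atom_orthonormal:
  assumes "i \<in> UNIV \<times> range (dual_vec p)" "j \<in> UNIV \<times> range (dual_vec p)"
  shows "(\<integral>x. atom i x * cnj (atom j x) \<partial>lborel) = (if i = j then 1 else 0)"
proof -
  obtain k m k' m' where ij: "i = (k, dual_vec p m)" "j = (k', dual_vec p m')"
    using assms by auto
  show ?thesis
  proof (cases "k = k'")
    case False
    then have "(\<lambda>x. atom i x * cnj (atom j x)) = (\<lambda>x. 0)"
      using disj[of k _ k']
      by (auto simp: fun_eq_iff atom_def ij freq_dilation_def tile_atom_def tile_window_def indicator_def)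
    then show ?thesis
      using False by (simp only:) (simp add: ij)
  next
    case True
    define v where "v = (\<Prod>i\<in>UNIV. p $ i)"
    have v: "v > 0"
      unfolding v_def using p by (intro prod_pos) auto
    have s: "complex_of_real (1 / sqrt v) * complex_of_real (1 / sqrt v) = of_real (1 / v)"
      using v by (simp flip: of_real_mult)
    have "(\<integral>x. atom i x * cnj (atom j x) \<partial>lborel)
        = (\<integral>x. tile_atom p A (dual_vec p m) x * cnj (tile_atom p A (dual_vec p m') x) \<partial>lborel)"
      unfolding atom_def ij prod.case True by (rule integral_freq_dilation[OF B]) measurable
    also have "\<dots> = (\<integral>x. of_real (1 / v) *
        (indicator A x *\<^sub>R (wave (dual_vec p (- m)) x * cnj (wave (dual_vec p (- m')) x))) \<partial>lborel)"
      by (rule Bochner_Integration.integral_cong[OF refl], unfold s[symmetric])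
        (simp add: tile_atom_def tile_window_def v_def dual_vec_minus indicator_def)
    also have "\<dots> = of_real (1 / v) *
        (\<integral>x. indicator A x *\<^sub>R (wave (dual_vec p (- m)) x * cnj (wave (dual_vec p (- m')) x)) \<partial>lborel)"
      by (rule integral_mult_right_zero)
    also have "(\<integral>x. indicator A x *\<^sub>R (wave (dual_vec p (- m)) x * cnj (wave (dual_vec p (- m')) x)) \<partial>lborel)
        = (\<integral>x. wave (dual_vec p (- m)) x * cnj (wave (dual_vec p (- m')) x) \<partial>lborel_restr A)"
      by (subst integral_density[where g = "\<lambda>x. indicator A x", simplified ennreal_indicator]) auto
    also have "\<dots> = (if m = m' then of_real v else 0)"
      using integral_wave_tile[OF p A(1), of "- m" "- m'"] by (simp add: v_def)
    finally show ?thesis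
      using v True by (simp add: ij dual_vec_eq_iff[OF p_nonzero])
  qed
qed

text \<open>Undoing the dilation moves \<open>f\<close> onto the tile, where waves are dense;
  dilating back is isometric and preserves the approximation.\<close>

lemma atom_complete_piece:
  assumes f: "f \<in> L2 lborel" and supp: "\<And>x. f x \<noteq> 0 \<Longrightarrow> transpose (B k) *v x \<in> A"
  shows "f \<in> L2_closure lborel (lin_comb (UNIV \<times> range (dual_vec p)) atom)"
proof (rule L2_closureI[OF f])
  let ?V = "lin_comb (UNIV \<times> range (dual_vec p)) atom"
  let ?T = "transpose (B k)"
  note C = csubspace_lin_comb[of "UNIV \<times> range (dual_vec p)" atom]
  fix e :: real assume "e > 0"
  have [measurable]: "f \<in> borel_measurable borel"
    using L2_measurable[OF f] by simp
  have T: "det ?T \<noteq> 0"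
    using B[of k] by simp
  define h where "h x = f (matrix_inv ?T *v x) / of_real (sqrt \<bar>det (B k)\<bar>)" for x
  have [measurable]: "h \<in> borel_measurable borel"
    unfolding h_def by measurable
  have fh: "freq_dilation (B k) h = f"
    using B[of k] by (simp add: fun_eq_iff freq_dilation_def h_def matrix_inv_vector_cancel[OF T] del: transpose_matrix_vector)
  then have h: "h \<in> L2 lborel"
    using f L2_freq_dilation(1)[OF B, of h k] by simp
  have "h x = 0" if "x \<notin> A" for x
    using supp[of "matrix_inv ?T *v x"] that
    by (auto simp: h_def matrix_inv_vector_cancel[OF T] simp del: transpose_matrix_vector)
  then have Ah: "indicator A x * h x = h x" for x
    by (auto simp: indicator_def)
  then have "(\<lambda>x. indicator A x * h x) = h"
    by (rule ext)
  then have "h \<in> L2 (lborel_restr A)"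
    using h by (subst L2_lborel_restr(1)) (simp_all only: A_borel \<open>h \<in> borel_measurable borel\<close>)
  then have "h \<in> L2_closure (lborel_restr A) (lin_comb UNIV (\<lambda>n. wave (dual_vec p n)))"
    using wave_complete_tile[OF p A(1)] by blast
  then obtain g where g: "g \<in> lin_comb UNIV (\<lambda>n. wave (dual_vec p n))"
      and le: "L2_sqnorm (lborel_restr A) (\<lambda>x. h x - g x) < e"
    using \<open>e > 0\<close> by (rule L2_closureE)
  \<comment> \<open>A subspace containing the waves, hence all their combinations; membership says
    that cutting off to the tile and dilating lands in the span of the atoms.\<close>
  define W where "W = {g \<in> borel_measurable borel. freq_dilation (B k) (\<lambda>x. indicator A x * g x) \<in> ?V}"
  have "csubspace W"
    unfolding csubspace_def
  proof (intro conjI ballI allI)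
    show "(\<lambda>x. 0) \<in> W"
      using csubspace_zero[OF C] by (simp add: W_def freq_dilation_def[abs_def])
    show "(\<lambda>x. f x + g x) \<in> W" if "f \<in> W" "g \<in> W" for f g
      using csubspace_add[OF C, of "freq_dilation (B k) (\<lambda>x. indicator A x * f x)" "freq_dilation (B k) (\<lambda>x. indicator A x * g x)"] that
      by (auto simp: W_def freq_dilation_def[abs_def] algebra_simps)
    show "(\<lambda>x. c * f x) \<in> W" if "f \<in> W" for f c
      using csubspace_cmult[OF C, of "freq_dilation (B k) (\<lambda>x. indicator A x * f x)" c] that
      by (auto simp: W_def freq_dilation_def[abs_def] ac_simps)
  qed
  moreover have "wave (dual_vec p n) \<in> W" for n
  proof -
    define v where "v = (\<Prod>i\<in>UNIV. p $ i)"
    have v: "v > 0"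
      unfolding v_def using p by (intro prod_pos) auto
    have "(\<lambda>x. of_real (sqrt v) * atom (k, dual_vec p (- n)) x) \<in> ?V"
      by (intro csubspace_cmult[OF C] lin_comb_base) auto
    also have "(\<lambda>x. of_real (sqrt v) * atom (k, dual_vec p (- n)) x)
        = freq_dilation (B k) (\<lambda>x. indicator A x * wave (dual_vec p n) x)"
      using v by (simp add: fun_eq_iff atom_def freq_dilation_def tile_atom_def tile_window_def dual_vec_minus
          flip: v_def)
    finally show ?thesis
      by (simp add: W_def)
  qed
  ultimately have "lin_comb UNIV (\<lambda>n. wave (dual_vec p n)) \<subseteq> W"
    by (intro lin_comb_subset)
  with g have gW: "freq_dilation (B k) (\<lambda>x. indicator A x * g x) \<in> ?V" and [measurable]: "g \<in> borel_measurable borel"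
    by (auto simp: W_def)
  have "L2_sqnorm lborel (\<lambda>x. f x - freq_dilation (B k) (\<lambda>x. indicator A x * g x) x)
      = L2_sqnorm lborel (freq_dilation (B k) (\<lambda>x. indicator A x * (h x - g x)))"
    by (subst fh[symmetric]) (simp add: freq_dilation_def[abs_def] right_diff_distrib Ah)
  also have "\<dots> = L2_sqnorm (lborel_restr A) (\<lambda>x. h x - g x)"
    by (simp add: L2_freq_dilation(2)[OF B] L2_lborel_restr(2))
  finally show "\<exists>g\<in>?V. L2_sqnorm lborel (\<lambda>x. f x - g x) < e"
    using gW le by (intro bexI[of _ "freq_dilation (B k) (\<lambda>x. indicator A x * g x)"]) simp
qed

text \<open>The dilated copies of the tile partition almost all of the space; being countably many,
  they are exhausted by finite subfamilies, and finite sums of pieces of \<open>f\<close> converge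
  to \<open>f\<close>.\<close>

lemma atom_complete:
  "L2 lborel \<subseteq> L2_closure lborel (lin_comb (UNIV \<times> range (dual_vec p)) atom)"
proof
  let ?V = "lin_comb (UNIV \<times> range (dual_vec p)) atom"
  have V: "?V \<subseteq> L2 lborel"
    using atom_bdd by (intro lin_comb_subset csubspace_L2 L2_bddD)
  note C = csubspace_L2_closure[OF csubspace_lin_comb V]
  fix f :: "real^'n::_ \<Rightarrow> complex" assume f: "f \<in> L2 lborel"
  have [measurable]: "f \<in> borel_measurable borel"
    using L2_measurable[OF f] by simp
  define S where "S k = {x. transpose (B k) *v x \<in> A}" for k
  define K where "K n = {k :: 'k. to_nat k < n}" for n
  have finK: "finite (K n)" for n
    using finite_vimageI[of "{..<n}" "to_nat :: 'k \<Rightarrow> nat"] by (simp add: K_def vimage_def)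
  have [measurable]: "S k \<in> sets borel" for k
    using measurable_sets[OF borel_measurable_matrix_vector A_borel, of "transpose (B k)"]
    by (simp add: S_def vimage_def)
  define g where "g n x = (\<Sum>k\<in>K n. indicator (S k) x * f x)" for n x
  have g_eq: "g n x = (if k \<in> K n then f x else 0)" if "x \<in> S k" for n x k
  proof -
    have "indicator (S k') x * f x = (if k' = k then f x else 0)" for k'
      using disj[of k x k'] that unfolding S_def by (cases "k' = k") (auto simp: indicator_def)
    then have "g n x = (\<Sum>k'\<in>K n. if k' = k then f x else 0)"
      unfolding g_def by (intro sum.cong refl)
    then show ?thesis
      using finK[of n] by simp
  qed
  have g_eq0: "g n x = 0" if "\<And>k. x \<notin> S k" for n x
    using that by (simp add: g_def)
  show "f \<in> L2_closure lborel ?V"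
  proof (rule L2_closure_dominated[OF V])
    show "integrable lborel (\<lambda>x. (norm (f x))\<^sup>2)"
      using f by (rule L2_integrable)
    fix n
    show "g n \<in> L2_closure lborel ?V"
      unfolding g_def[abs_def]
    proof (intro csubspace_sum[OF C] atom_complete_piece)
      fix k
      show "(\<lambda>x. indicator (S k) x * f x) \<in> L2 lborel"
        by (rule L2_bound[OF _ f, where C = 1]) (auto simp: indicator_def)
      fix x assume "indicator (S k) x * f x \<noteq> 0"
      then show "transpose (B k) *v x \<in> A"
        by (auto simp: S_def indicator_def split: if_splits)
    qed
    show "norm (g n x) \<le> norm (f x)" for x
      using g_eq[of x] g_eq0[of x] by (cases "\<exists>k. x \<in> S k") auto
  next
    show "AE x in lborel. (\<lambda>n. g n x) \<longlonglongrightarrow> f x"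
      using cover
    proof eventually_elim
      case (elim x)
      then obtain k where k: "x \<in> S k"
        by (auto simp: S_def)
      have "eventually (\<lambda>n. g n x = f x) sequentially"
        using eventually_gt_at_top[of "to_nat k"] by eventually_elim (simp add: g_eq[OF k] K_def)
      then show ?case
        by (rule tendsto_eventually)
    qed
  qed simp
qed

theorem riesz_basis_atom:
  "riesz_basis_L2 lebesgue (UNIV \<times> range (dual_vec p)) (\<lambda>i. fourier (atom i))"
  by (intro riesz_basis_fourier atom_bdd atom_orthonormal atom_complete)

end

text \<open>Needed because the locale indexes the basis by \<open>((k, m), l)\<close> and the final
  statement by \<open>(k, m, l)\<close>.\<close>

lemma riesz_basis_L2_reindex:
  assumes h: "bij_betw h I I'" and basis: "riesz_basis_L2 M I' g"
  shows "riesz_basis_L2 M I (\<lambda>i. g (h i))"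
  unfolding riesz_basis_L2_def
proof (intro conjI ballI allI impI)
  have inj: "inj_on h J" if "J \<subseteq> I" for J
    using h that by (auto simp: bij_betw_def inj_on_subset)
  have img: "h ` J \<subseteq> I'" if "J \<subseteq> I" for J
    using h that by (auto simp: bij_betw_def)
  show "g (h i) \<in> L2 M" if "i \<in> I" for i
    using basis h that by (auto simp: riesz_basis_L2_def bij_betw_def)
  show "\<exists>J u. finite J \<and> J \<subseteq> I \<and> L2_norm M (\<lambda>x. f x - (\<Sum>i\<in>J. u i * g (h i) x)) < \<epsilon>"
    if "f \<in> L2 M" "0 < \<epsilon>" for f \<epsilon>
  proof -
    have "\<forall>f\<in>L2 M. \<forall>\<epsilon>>0. \<exists>J u. finite J \<and> J \<subseteq> I' \<and> L2_norm M (\<lambda>x. f x - (\<Sum>i\<in>J. u i * g i x)) < \<epsilon>"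
      using basis unfolding riesz_basis_L2_def by (elim conjE)
    from this[rule_format, OF that] obtain J u
      where J: "finite J" "J \<subseteq> I'" "L2_norm M (\<lambda>x. f x - (\<Sum>i\<in>J. u i * g i x)) < \<epsilon>"
      by (elim exE conjE)
    define J' where "J' = {i \<in> I. h i \<in> J}"
    have J': "J' \<subseteq> I" "J = h ` J'"
      using h J(2) by (auto simp: J'_def bij_betw_def)
    then have "(\<Sum>i\<in>J. u i * g i x) = (\<Sum>i\<in>J'. u (h i) * g (h i) x)" for x
      by (simp add: sum.reindex[OF inj])
    with J J' inj[of J'] show ?thesis
      by (intro exI[of _ J'] exI[of _ "\<lambda>i. u (h i)"]) (auto simp: finite_image_iff)
  qed
  obtain C1 C2 where C: "0 < C1" "C1 \<le> C2"
    and bound: "\<And>J u. finite J \<Longrightarrow> J \<subseteq> I' \<Longrightarrow>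
      C1 * (\<Sum>i\<in>J. (norm (u i))\<^sup>2) \<le> (L2_norm M (\<lambda>x. \<Sum>i\<in>J. u i * g i x))\<^sup>2 \<and>
      (L2_norm M (\<lambda>x. \<Sum>i\<in>J. u i * g i x))\<^sup>2 \<le> C2 * (\<Sum>i\<in>J. (norm (u i))\<^sup>2)"
    using basis unfolding riesz_basis_L2_def by (elim conjE exE) simp
  have "C1 * (\<Sum>i\<in>J. (norm (u i))\<^sup>2) \<le> (L2_norm M (\<lambda>x. \<Sum>i\<in>J. u i * g (h i) x))\<^sup>2 \<and>
      (L2_norm M (\<lambda>x. \<Sum>i\<in>J. u i * g (h i) x))\<^sup>2 \<le> C2 * (\<Sum>i\<in>J. (norm (u i))\<^sup>2)"
    if "finite J" "J \<subseteq> I" for J u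
    using bound[of "h ` J" "\<lambda>i. u (the_inv_into J h i)"] that inj[of J] img[of J]
    by (simp add: sum.reindex the_inv_into_f_f)
  then show "\<exists>C1 C2. 0 < C1 \<and> C1 \<le> C2 \<and> (\<forall>J u. finite J \<and> J \<subseteq> I \<longrightarrow>
      C1 * (\<Sum>i\<in>J. (norm (u i))\<^sup>2) \<le> (L2_norm M (\<lambda>x. \<Sum>i\<in>J. u i * g (h i) x))\<^sup>2 \<and>
      (L2_norm M (\<lambda>x. \<Sum>i\<in>J. u i * g (h i) x))\<^sup>2 \<le> C2 * (\<Sum>i\<in>J. (norm (u i))\<^sup>2))"
    using C by (intro exI[of _ C1] exI[of _ C2] conjI allI impI) auto
qed

subsection \<open>The tile\<close>

text \<open>
  With \<open>j = \<lfloor>t / (b (a + 1))\<rfloor>\<close>, the cell is the union of the strips \<open>1 + j p \<le> x < 1 + (j + 1) p\<close> of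
  the trapezoid over \<open>[1, a)\<close>, of height \<open>b x\<close> and with bottom moved to \<open>b (a + 1) j\<close>, and of the
  strips of the trapezoid over \<open>[-a, -1)\<close>, of height \<open>- b x\<close>. Translation by the multiple
  \<open>a + 1\<close> of \<open>p\<close> puts the latter exactly on top of the former.
\<close>

locale shear_cell =
  fixes a b p :: real and N M :: int
  assumes a: "a > 1" and b: "b > 0" and N: "N > 0"
    and pN: "of_int N * p = a - 1" and pM: "of_int M * p = a + 1"
begin

definition cell :: "real \<Rightarrow> real \<Rightarrow> bool" where
  "cell x t \<longleftrightarrow> (let j = \<lfloor>t / (b * (a + 1))\<rfloor> in 0 \<le> j \<and> j < N \<and>
     (\<lfloor>(x - 1) / p\<rfloor> = j \<and> t < b * (a + 1) * j + b * x \<or>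
      \<lfloor>(x + a) / p\<rfloor> = j \<and> b * (a + 1) * j + b * (x + a + 1) \<le> t))"

lemma p: "p > 0"
  using pN a N by (smt (verit) mult_nonneg_nonpos of_int_0_less_iff)

lemma height_pos: "b * (a + 1) > 0"
  using a b by simp

lemma M_gt_N: "M > N"
proof -
  have "of_int N * p < of_int M * p"
    using pN pM by simp
  then show ?thesis
    using p by simp
qed

text \<open>The numerators differ by \<open>a + 1\<close>, which is \<open>M\<close> periods; so the
  strip indices used for the two halves differ by a constant.\<close>

lemma floor_shift: "\<lfloor>(x + a) / p\<rfloor> = \<lfloor>(x - 1) / p\<rfloor> + M"
proof -
  have "(x + a) / p = (x - 1) / p + of_int M"
    using p pM by (simp add: field_simps)
  then show ?thesis
    by simp
qed

text \<open>Reducing \<open>\<lfloor>t / H\<rfloor>\<close> modulo \<open>N\<close> determines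
  \<open>l\<close>, and the remainder \<open>j\<close> prescribes the strip. Modulo \<open>p\<close>
  only two horizontal positions are then possible, one in each half and \<open>M\<close> periods
  apart; the slanted line at height \<open>H * j + b * y\<close> gives the point to exactly one of
  them.\<close>

lemma cell_translates:
  "\<exists>m n. \<forall>k l. cell (x + p * of_int k) (t + of_int N * (b * (a + 1)) * of_int l) \<longleftrightarrow> k = m \<and> l = n"
proof -
  define H where "H = b * (a + 1)"
  have H: "H > 0"
    using height_pos by (simp add: H_def)
  define n where "n = - (\<lfloor>t / H\<rfloor> div N)"
  define j where "j = \<lfloor>t / H\<rfloor> mod N"
  define s where "s = t + of_int N * H * of_int n"
  define i where "i = \<lfloor>(x - 1) / p\<rfloor>"
  \<comment> \<open>The representative of \<open>x\<close> modulo \<open>p\<close> in strip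
    \<open>j\<close> of the right half.\<close>
  define y where "y = x + p * of_int (j - i)"
  define m where "m = (if s < H * of_int j + b * y then j - i else j - i - M)"
  have fl: "\<lfloor>(t + of_int N * H * of_int l) / H\<rfloor> = \<lfloor>t / H\<rfloor> + N * l" for l
  proof -
    have "(t + of_int N * H * of_int l) / H = t / H + of_int (N * l)"
      using H by (simp add: field_simps)
    then show ?thesis
      by (simp del: of_int_mult)
  qed
  have fx: "\<lfloor>(x + p * of_int k - 1) / p\<rfloor> = i + k" for k
  proof -
    have "(x + p * of_int k - 1) / p = (x - 1) / p + of_int k"
      using p by (simp add: field_simps)
    then show ?thesis
      by (simp add: i_def)
  qed
  have l: "0 \<le> \<lfloor>t / H\<rfloor> + N * l \<and> \<lfloor>t / H\<rfloor> + N * l < N \<longleftrightarrow> l = n" for l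
  proof
    assume *: "0 \<le> \<lfloor>t / H\<rfloor> + N * l \<and> \<lfloor>t / H\<rfloor> + N * l < N"
    have "(\<lfloor>t / H\<rfloor> + N * l) div N = 0"
      using * by (intro div_pos_pos_trivial) auto
    then show "l = n"
      using N by (simp add: n_def)
  next
    assume "l = n"
    then show "0 \<le> \<lfloor>t / H\<rfloor> + N * l \<and> \<lfloor>t / H\<rfloor> + N * l < N"
      using N pos_mod_bound[of N "\<lfloor>t / H\<rfloor>"] pos_mod_sign[of N "\<lfloor>t / H\<rfloor>"]
      by (simp add: n_def minus_mult_div_eq_mod)
  qed
  have jn: "\<lfloor>t / H\<rfloor> + N * n = j"
    by (simp add: n_def j_def minus_mult_div_eq_mod)
  have "cell (x + p * of_int k) (t + of_int N * H * of_int l) \<longleftrightarrow> k = m \<and> l = n" for k l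
  proof -
    have "cell (x + p * of_int k) (t + of_int N * H * of_int l) \<longleftrightarrow> l = n \<and>
        (i + k = j \<and> s < H * of_int j + b * (x + p * of_int k) \<or>
         i + k + M = j \<and> H * of_int j + b * (x + p * of_int k + a + 1) \<le> s)"
      unfolding cell_def Let_def floor_shift H_def[symmetric] fl fx
      using l[of l] jn by (auto simp: s_def)
    also have "\<dots> \<longleftrightarrow> l = n \<and>
        (k = j - i \<and> s < H * of_int j + b * y \<or> k = j - i - M \<and> H * of_int j + b * y \<le> s)"
    proof -
      have "x + p * of_int k = y" if "i + k = j"
        using that by (auto simp: y_def)
      moreover have "x + p * of_int k + a + 1 = y" if "i + k + M = j"
        using that pM by (auto simp: y_def algebra_simps)
      moreover have "i + k = j \<longleftrightarrow> k = j - i" "i + k + M = j \<longleftrightarrow> k = j - i - M"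
        by auto
      ultimately show ?thesis
        by metis
    qed
    also have "\<dots> \<longleftrightarrow> k = m \<and> l = n"
      by (auto simp: m_def)
    finally show ?thesis .
  qed
  then show ?thesis
    unfolding H_def by blast
qed

section \<open>Range and fibres of the cell\<close>

lemma floor_range:
  assumes "1 \<le> x" "x < a"
  shows "0 \<le> \<lfloor>(x - 1) / p\<rfloor>" "\<lfloor>(x - 1) / p\<rfloor> < N"
proof -
  show "0 \<le> \<lfloor>(x - 1) / p\<rfloor>"
    using assms p by simp
  have "(x - 1) / p < of_int N"
    using assms p pN by (simp add: field_simps)
  then show "\<lfloor>(x - 1) / p\<rfloor> < N"
    by (simp add: floor_less_iff)
qed

lemma floor_range_conv:
  assumes "0 \<le> \<lfloor>(x - 1) / p\<rfloor>" "\<lfloor>(x - 1) / p\<rfloor> < N"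
  shows "1 \<le> x" "x < a"
proof -
  have "0 \<le> (x - 1) / p"
    using assms(1) by simp
  then show "1 \<le> x"
    using p by (simp add: field_simps)
  have "(x - 1) / p < of_int N"
    using assms(2) by (simp add: floor_less_iff)
  then show "x < a"
    using p pN by (simp add: field_simps)
qed

lemma cell_range:
  assumes "cell x t"
  shows "1 \<le> x \<and> x < a \<or> - a \<le> x \<and> x < - 1"
proof -
  have "0 \<le> \<lfloor>(x - 1) / p\<rfloor> \<and> \<lfloor>(x - 1) / p\<rfloor> < N \<or> 0 \<le> \<lfloor>(x + a) / p\<rfloor> \<and> \<lfloor>(x + a) / p\<rfloor> < N"
    using assms unfolding cell_def Let_def by metis
  \<comment> \<open>Reduces the left half to the right one by the translation
    \<open>a + 1\<close>.\<close>
  moreover have "x + a + 1 - 1 = x + a"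
    by simp
  ultimately show ?thesis
    using floor_range_conv[of x] floor_range_conv[of "x + a + 1"] by (auto simp del: zero_le_floor)
qed

lemma cell_height:
  assumes "cell x t"
  shows "0 \<le> t" "t < b * (a + 1) * N"
proof -
  have j: "0 \<le> \<lfloor>t / (b * (a + 1))\<rfloor>" "\<lfloor>t / (b * (a + 1))\<rfloor> < N"
    using assms by (simp_all only: cell_def Let_def)
  then have "0 \<le> t / (b * (a + 1))" "t / (b * (a + 1)) < of_int N"
    by (simp_all add: floor_less_iff)
  then show "0 \<le> t" "t < b * (a + 1) * N"
    using height_pos by (simp_all add: field_simps)
qed

lemma floor_div_eqI:
  assumes "(H :: real) > 0" "H * of_int j \<le> t" "t < H * (of_int j + 1)"
  shows "\<lfloor>t / H\<rfloor> = j"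
  using assms by (intro floor_unique) (simp_all add: field_simps)

lemma floor_div_bounds:
  assumes "(H :: real) > 0"
  shows "H * of_int \<lfloor>t / H\<rfloor> \<le> t" "t < H * (of_int \<lfloor>t / H\<rfloor> + 1)"
  using assms floor_divide_lower[of H t] floor_divide_upper[of H t] by (simp_all add: mult.commute)

text \<open>Only one alternative of \<open>cell\<close> can hold: the other would require the layer
  \<open>j + M\<close> or \<open>j - M\<close>, out of range because \<open>M > N\<close>. Within
  the layer of height \<open>H = b * (a + 1)\<close>, the right half takes the lowest
  \<open>b * x\<close>, and the left half what lies above \<open>b * (x + a + 1)\<close>, a height
  of \<open>- b * x\<close>.\<close>

lemma cell_fibre:
  assumes "1 \<le> x \<and> x < a \<or> - a \<le> x \<and> x < - 1"
  obtains lo where "\<And>t. cell x t \<longleftrightarrow> lo \<le> t \<and> t < lo + b * \<bar>x\<bar>"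
  using assms
proof (elim disjE conjE)
  define H where "H = b * (a + 1)"
  have H: "H > 0"
    using height_pos by (simp add: H_def)
  {
    assume x: "1 \<le> x" "x < a"
    define j where "j = \<lfloor>(x - 1) / p\<rfloor>"
    have j: "0 \<le> j" "j < N"
      using floor_range[OF x] by (simp_all add: j_def)
    have bx: "b * x < H"
      using b x by (simp add: H_def)
    have "cell x t \<longleftrightarrow> H * of_int j \<le> t \<and> t < H * of_int j + b * \<bar>x\<bar>" for t
    proof -
      have "cell x t \<longleftrightarrow> \<lfloor>t / H\<rfloor> = j \<and> t < H * of_int j + b * x"
        using j M_gt_N by (auto simp: cell_def Let_def floor_shift simp flip: H_def j_def)
      also have "\<dots> \<longleftrightarrow> H * of_int j \<le> t \<and> t < H * of_int j + b * x"
        using floor_div_eqI[OF H, of j t] floor_div_bounds[OF H, of t] bx by (auto simp: distrib_left)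
      finally show ?thesis
        using x by simp
    qed
    then show ?thesis
      by (rule that)
  next
    assume x: "- a \<le> x" "x < - 1"
    define j where "j = \<lfloor>(x + a) / p\<rfloor>"
    have j: "0 \<le> j" "j < N"
      using floor_range[of "x + a + 1"] x by (simp_all add: j_def)
    have bx: "0 \<le> b * (x + a + 1)"
      using b x by simp
    have jx: "\<lfloor>(x - 1) / p\<rfloor> = j - M"
      by (simp add: j_def floor_shift)
    have top: "H * (of_int j + 1) = H * of_int j + b * (x + a + 1) + b * \<bar>x\<bar>"
      using x by (simp add: H_def algebra_simps)
    have "cell x t \<longleftrightarrow> H * of_int j + b * (x + a + 1) \<le> t \<and> t < H * of_int j + b * (x + a + 1) + b * \<bar>x\<bar>" for t
    proof -
      have "cell x t \<longleftrightarrow> \<lfloor>t / H\<rfloor> = j \<and> H * of_int j + b * (x + a + 1) \<le> t"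
        using j M_gt_N jx by (auto simp: cell_def Let_def simp del: zero_le_floor simp flip: H_def j_def)
      also have "\<dots> \<longleftrightarrow> H * of_int j + b * (x + a + 1) \<le> t \<and> t < H * (of_int j + 1)"
        using floor_div_eqI[OF H, of j t] floor_div_bounds[OF H, of t] bx by auto
      finally show ?thesis
        by (simp only: top)
    qed
    then show ?thesis
      by (rule that)
  }
qed

definition cell_set :: "(real^2) set" where
  "cell_set = {\<xi>. cell (\<xi> $ 1) (\<xi> $ 2)}"

definition cell_period :: "real^2" where
  "cell_period = vector [p, of_int N * (b * (a + 1))]"

lemma cell_period_pos: "\<forall>i. cell_period $ i > 0"
  using p N height_pos by (simp add: forall_2 cell_period_def)

lemma tile_cell_set: "tile cell_period cell_set"
  unfolding tile_def
proof (intro conjI allI)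
  have [measurable]: "(\<lambda>\<xi> :: real^2. \<xi> $ i) \<in> borel_measurable borel" for i
    by (intro borel_measurable_continuous_onI continuous_intros)
  have "Measurable.pred borel (\<lambda>\<xi> :: real^2. cell (\<xi> $ 1) (\<xi> $ 2))"
    unfolding cell_def Let_def by measurable
  then show "cell_set \<in> sets borel"
    by (simp add: cell_set_def pred_def)
  fix x :: "real^2"
  obtain m n where "\<forall>k l. cell (x $ 1 + p * of_int k) (x $ 2 + of_int N * (b * (a + 1)) * of_int l) \<longleftrightarrow> k = m \<and> l = n"
    using cell_translates by blast
  then have "x + lattice_vec cell_period k \<in> cell_set \<longleftrightarrow> k = vector [m, n]" for k
    by (simp add: cell_set_def cell_period_def lattice_vec_def vec_eq_iff forall_2)
  then show "\<exists>!k. x + lattice_vec cell_period k \<in> cell_set"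
    by auto
qed

lemma bounded_cell_set: "bounded cell_set"
proof -
  have "norm \<xi> \<le> a + b * (a + 1) * N" if "\<xi> \<in> cell_set" for \<xi>
  proof -
    have "\<bar>\<xi> $ 1\<bar> \<le> a" "\<bar>\<xi> $ 2\<bar> \<le> b * (a + 1) * N"
      using cell_range[of "\<xi> $ 1" "\<xi> $ 2"] cell_height[of "\<xi> $ 1" "\<xi> $ 2"] that a
      by (auto simp: cell_set_def)
    moreover have "norm \<xi> \<le> \<bar>\<xi> $ 1\<bar> + \<bar>\<xi> $ 2\<bar>"
      using norm_le_l1_cart[of \<xi>] by (simp add: sum_2)
    ultimately show ?thesis
      by simp
  qed
  then show ?thesis
    by (auto simp: bounded_iff)
qed

text \<open>One inequality suffices by symmetry. A larger exponent enlarges the modulus by a factor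
  of at least \<open>a\<close>, too much for either half-open range.\<close>

lemma powi_range_unique:
  assumes "\<bar>x\<bar> > 0" "1 \<le> a powi k * x \<and> a powi k * x < a \<or> - a \<le> a powi k * x \<and> a powi k * x < - 1"
    "1 \<le> a powi l * x \<and> a powi l * x < a \<or> - a \<le> a powi l * x \<and> a powi l * x < - 1"
  shows "k \<le> l"
proof (rule ccontr)
  assume "\<not> k \<le> l"
  then have "a powi (l + 1) \<le> a powi k"
    using a by (intro power_int_increasing) auto
  then have le: "a * a powi l \<le> a powi k"
    using a by (simp add: power_int_add mult.commute)
  have pos: "a powi k > 0" "a powi l > 0"
    using a by simp_all
  show False
  proof (cases "x > 0")
    case True
    have "\<not> a powi k * x < 0" "\<not> a powi l * x < 0"
      using pos True by (simp_all add: not_less)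
    then have k: "a powi k * x < a" and l: "1 \<le> a powi l * x"
      using assms by linarith+
    have "a * 1 \<le> a * (a powi l * x)"
      using l a by (intro mult_left_mono) auto
    also have "\<dots> \<le> a powi k * x"
      using mult_right_mono[OF le, of x] True by (simp add: mult.assoc)
    finally show False
      using k by simp
  next
    case False
    then have x: "x < 0"
      using assms(1) by simp
    have "\<not> a powi k * x > 0" "\<not> a powi l * x > 0"
      using pos x by (simp_all add: not_less mult_pos_neg less_imp_le)
    then have k: "- a \<le> a powi k * x" and l: "a powi l * x < - 1"
      using assms by linarith+
    have "a powi k * x \<le> a * (a powi l * x)"
      using mult_right_mono_neg[OF le, of x] x by (simp add: mult.assoc)
    also have "\<dots> < a * (- 1)"
      using l a by (intro mult_strict_left_mono) auto
    finally show False
      using k by simp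
  qed
qed

lemma powi_range_exists:
  assumes "x \<noteq> 0"
  obtains k :: int where "1 \<le> a powi k * x \<and> a powi k * x < a \<or> - a \<le> a powi k * x \<and> a powi k * x < - 1"
proof (cases "x > 0")
  case True
  define k where "k = - \<lfloor>log a x\<rfloor>"
  have "a powr of_int (- k) \<le> x" "x < a powr (of_int (- k) + 1)"
    using floor_log_eq_powr_iff[of x a "- k"] True a by (simp_all add: k_def)
  moreover have e: "a powi k = a powr of_int k"
    using a by (simp add: powr_real_of_int')
  ultimately have "a powr of_int k * a powr of_int (- k) \<le> a powi k * x"
    "a powi k * x < a powr of_int k * a powr (of_int (- k) + 1)"
    using a by (auto intro!: mult_left_mono mult_strict_left_mono)
  then have "1 \<le> a powi k * x \<and> a powi k * x < a"
    using a by (simp flip: powr_add)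
  then show ?thesis
    using that by blast
next
  case False
  \<comment> \<open>For negative \<open>x\<close> the condition reads
    \<open>1 < a powi k * \<bar>x\<bar>\<close> and \<open>a powi k * \<bar>x\<bar> \<le> a\<close>,
    closed at the wrong end for a floor. In terms of the reciprocal of \<open>\<bar>x\<bar>\<close>
    it becomes \<open>a powr (k - 1) \<le> y\<close> and \<open>y < a powr k\<close>, which a floor
    solves.\<close>
  define y where "y = - 1 / x"
  have y: "y > 0"
    using False assms by (simp add: y_def)
  define k where "k = \<lfloor>log a y\<rfloor> + 1"
  have "a powr (of_int k - 1) \<le> y" "y < a powr of_int k"
    using floor_log_eq_powr_iff[of y a "k - 1"] y a by (simp_all add: k_def)
  moreover have e: "a powi k = a powr of_int k"
    using a by (simp add: powr_real_of_int')
  ultimately have "a powi k \<le> a * y" "y < a powi k"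
    using a by (simp_all add: powr_diff field_simps)
  moreover have "y * x = - 1"
    using assms by (simp add: y_def)
  moreover have "a * y * x \<le> a powi k * x"
    using \<open>a powi k \<le> a * y\<close> False by (intro mult_right_mono_neg) auto
  moreover have "a powi k * x < y * x"
    using \<open>y < a powi k\<close> False assms by (intro mult_strict_right_mono_neg) auto
  ultimately have "- a \<le> a powi k * x \<and> a powi k * x < - 1"
    by (simp add: mult.assoc)
  then show ?thesis
    using that by blast
qed

section \<open>Dilations and shears acting on the cell\<close>

definition shearlet_matrix :: "real \<Rightarrow> int \<times> int \<Rightarrow> real^2^2" where
  "shearlet_matrix c = (\<lambda>(k, m). dilation_matrix c (a powi k) ** shear_matrix (of_int m * b))"

lemma det_dilation_matrix: "t > 0 \<Longrightarrow> det (dilation_matrix c t) \<noteq> 0"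
  and det_shear_matrix: "det (shear_matrix m) \<noteq> 0"
  by (simp_all add: det_2 dilation_matrix_def shear_matrix_def)

text \<open>After transposition the shear adds multiples of the already scaled first coordinate to
  the second, so \<open>k\<close> is found from the first coordinate alone and \<open>m\<close>
  afterwards from the second.\<close>

lemma shearlet_matrix_transpose:
  "transpose (shearlet_matrix c (k, m)) *v \<xi> \<in> cell_set \<longleftrightarrow>
     cell (a powi k * \<xi> $ 1) ((a powi k) powr c * \<xi> $ 2 + of_int m * b * (a powi k * \<xi> $ 1))"
  by (simp add: cell_set_def shearlet_matrix_def dilation_matrix_def shear_matrix_def
      matrix_matrix_mult_def vector_matrix_mult_def sum_2 algebra_simps)

lemma dilation_tiling: "dilation_tiling cell_period cell_set (shearlet_matrix c)"
proof
  show "\<forall>i. cell_period $ i > 0"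
    by (rule cell_period_pos)
  show "tile cell_period cell_set" "bounded cell_set"
    by (rule tile_cell_set bounded_cell_set)+
  show "det (shearlet_matrix c i) \<noteq> 0" for i
    using det_dilation_matrix det_shear_matrix a
    by (cases i) (simp add: shearlet_matrix_def det_mul)
next
  fix i i' and \<xi> :: "real^2"
  assume 1: "transpose (shearlet_matrix c i) *v \<xi> \<in> cell_set"
    and 2: "transpose (shearlet_matrix c i') *v \<xi> \<in> cell_set"
  obtain k m k' m' where i: "i = (k, m)" "i' = (k', m')"
    by (cases i, cases i')
  let ?x = "\<xi> $ 1"
  note c1 = 1[unfolded i shearlet_matrix_transpose] and c2 = 2[unfolded i shearlet_matrix_transpose]
  have "\<bar>?x\<bar> > 0"
    using cell_range[OF c1] by auto
  then have k: "k = k'"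
    using powi_range_unique cell_range[OF c1] cell_range[OF c2] by (intro antisym) blast+
  define x where "x = a powi k * ?x"
  define w where "w = (a powi k) powr c * \<xi> $ 2"
  obtain lo where lo: "\<And>t. cell x t \<longleftrightarrow> lo \<le> t \<and> t < lo + b * \<bar>x\<bar>"
    using cell_fibre[OF cell_range[OF c1]] by (auto simp: x_def)
  have x: "\<bar>x\<bar> > 0"
    using \<open>\<bar>?x\<bar> > 0\<close> a by (simp add: x_def)
  have "lo \<le> w + of_int m * b * x" "w + of_int m * b * x < lo + b * \<bar>x\<bar>"
    "lo \<le> w + of_int m' * b * x" "w + of_int m' * b * x < lo + b * \<bar>x\<bar>"
    using c1 c2 lo by (simp_all add: x_def w_def k)
  \<comment> \<open>Two points of a half-open interval of length \<open>b * \<bar>x\<bar>\<close>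
    that differ by an integer multiple of this length coincide.\<close>
  then have "\<bar>of_int m * b * x - of_int m' * b * x\<bar> < b * \<bar>x\<bar>"
    by linarith
  also have "of_int m * b * x - of_int m' * b * x = of_int (m - m') * (b * x)"
    by (simp add: algebra_simps)
  finally have "\<bar>of_int (m - m') :: real\<bar> * (b * \<bar>x\<bar>) < 1 * (b * \<bar>x\<bar>)"
    using b by (simp add: abs_mult)
  then have "\<bar>of_int (m - m') :: real\<bar> < 1"
    using b x by (simp only: mult_less_cancel_right_pos mult_pos_pos)
  then have "m = m'"
    by linarith
  then show "i = i'"
    using k i by simp
next
  \<comment> \<open>On this axis no scaling reaches the range of the cell.\<close>
  have null: "{\<xi> :: real^2. \<xi> $ 1 = 0} \<in> null_sets lborel"
  proof -
    have "{\<xi> :: real^2. \<xi> $ 1 = 0} \<in> sets lborel"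
      by (auto intro!: borel_closed closed_Collect_eq continuous_intros)
    moreover have "{\<xi> :: real^2. \<xi> $ 1 = 0} \<in> null_sets lebesgue"
      using negligible_standard_hyperplane_cart by (simp flip: negligible_iff_null_sets)
    ultimately show ?thesis
      by (simp add: null_sets_completion_iff)
  qed
  have "\<exists>i. transpose (shearlet_matrix c i) *v \<xi> \<in> cell_set" if nz: "\<xi> $ 1 \<noteq> 0" for \<xi>
  proof -
    obtain k where k: "1 \<le> a powi k * \<xi> $ 1 \<and> a powi k * \<xi> $ 1 < a \<or> - a \<le> a powi k * \<xi> $ 1 \<and> a powi k * \<xi> $ 1 < - 1"
      by (rule powi_range_exists[OF nz])
    define x where "x = a powi k * \<xi> $ 1"
    define w where "w = (a powi k) powr c * \<xi> $ 2"
    obtain lo where lo: "\<And>t. cell x t \<longleftrightarrow> lo \<le> t \<and> t < lo + b * \<bar>x\<bar>"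
      using cell_fibre[OF k] by (auto simp: x_def)
    have "\<bar>x\<bar> > 0"
      using k unfolding x_def by linarith
    then have "b * \<bar>x\<bar> > 0"
      using b by (rule mult_pos_pos[rotated])
    from half_open_box_Ex1[OF this, of "w - lo"] obtain n :: int
      where n: "0 \<le> w - lo + b * \<bar>x\<bar> * of_int n" "w - lo + b * \<bar>x\<bar> * of_int n < b * \<bar>x\<bar>"
      by blast
    \<comment> \<open>Shears move by \<open>b * x\<close>, the tiling of the line by
      \<open>b * \<bar>x\<bar>\<close>; the sign is absorbed into \<open>m\<close>.\<close>
    define m where "m = (if x > 0 then n else - n)"
    have "b * \<bar>x\<bar> * of_int n = of_int m * b * x"
      by (simp add: m_def)
    with n have "cell x (w + of_int m * b * x)"
      unfolding lo by linarith
    then have "transpose (shearlet_matrix c (k, m)) *v \<xi> \<in> cell_set"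
      by (simp only: shearlet_matrix_transpose x_def w_def)
    then show ?thesis
      by blast
  qed
  then show "AE \<xi> in lborel. \<exists>i. transpose (shearlet_matrix c i) *v \<xi> \<in> cell_set"
    by (intro AE_I'[OF null]) auto
qed

end

section \<open>Riesz bases from dilations, shears and translations\<close>

theorem corollary4p3:
  fixes c a b :: real
  assumes "a \<in> \<rat>" and "a > 1" and "b \<in> \<rat>" and "b > 0"
  shows "\<exists>(\<psi> :: real^2 \<Rightarrow> complex) (\<Lambda> :: (real^2) set).
           \<psi> \<in> L2 lebesgue \<and>
           riesz_basis_L2 lebesgue ((UNIV :: int set) \<times> (UNIV :: int set) \<times> \<Lambda>)
             (\<lambda>(k, m, l). dilation_op (dilation_matrix c (a powi k))
                (dilation_op (shear_matrix (of_int m * b)) (translation_op l \<psi>)))"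
proof -
  \<comment> \<open>Rationality of \<open>a\<close> enters here: if the quotient is
    \<open>M / N\<close>, then \<open>(a - 1) / N\<close> divides \<open>a - 1\<close> into
    \<open>N\<close> and \<open>a + 1\<close> into \<open>M\<close> equal parts.\<close>
  have "(a + 1) / (a - 1) \<in> \<rat>"
    using \<open>a \<in> \<rat>\<close> by (intro Rats_divide Rats_add Rats_diff) auto
  then obtain M N :: nat where MN: "N \<noteq> 0" "\<bar>(a + 1) / (a - 1)\<bar> = M / N"
    by (elim Rats_abs_nat_div_natE)
  interpret shear_cell a b "(a - 1) / N" "int N" "int M"
    using MN \<open>a > 1\<close> \<open>b > 0\<close> by unfold_locales (simp_all add: field_simps)
  interpret dilation_tiling cell_period cell_set "shearlet_matrix c"
    by (rule dilation_tiling)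
  define \<psi> where "\<psi> = fourier (tile_window cell_period cell_set)"
  let ?\<Lambda> = "range (dual_vec cell_period)"
  let ?h = "\<lambda>(k :: int, m :: int, l :: real^2). ((k, m), l)"
  have "\<psi> \<in> L2 lborel"
    unfolding \<psi>_def by (rule Plancherel[OF tile_window_bdd])
  then have \<psi>: "\<psi> \<in> L2 lebesgue"
    using L2_measurable L2_completion by blast
  have "dilation_op (dilation_matrix c (a powi k)) (dilation_op (shear_matrix (of_int m * b)) (translation_op l \<psi>))
      = fourier (atom ((k, m), l))" for k m l
  proof -
    have "translation_op l \<psi> = fourier (tile_atom cell_period cell_set l)"
      unfolding \<psi>_def translation_op_fourier tile_atom_def[abs_def] ..
    moreover have "dilation_op (dilation_matrix c (a powi k)) (dilation_op (shear_matrix (of_int m * b)) f)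
        = dilation_op (shearlet_matrix c (k, m)) f" for f
      using \<open>a > 1\<close> by (simp add: shearlet_matrix_def dilation_op_mult det_dilation_matrix det_shear_matrix)
    ultimately show ?thesis
      by (simp add: atom_def dilation_op_fourier[OF B])
  qed
  then have eq: "(\<lambda>(k, m, l). dilation_op (dilation_matrix c (a powi k))
        (dilation_op (shear_matrix (of_int m * b)) (translation_op l \<psi>))) = (\<lambda>i. fourier (atom (?h i)))"
    by (auto simp: fun_eq_iff)
  have "bij_betw ?h (UNIV \<times> UNIV \<times> ?\<Lambda>) (UNIV \<times> ?\<Lambda>)"
    by (rule bij_betwI[where g = "\<lambda>((k, m), l). (k, m, l)"]) auto
  from riesz_basis_L2_reindex[OF this riesz_basis_atom] \<psi> show ?thesis
    unfolding eq[symmetric] by blast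
qed

end
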